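(* Let $\alpha>-\frac12$. The operator $W_\alpha$ is a topological isomorphism from $\mathcal{D}(\mathbb{R})$ onto $\Delta_\alpha(\mathbb{R})$, and its inverse is the restriction $V_{\alpha|\Delta_\alpha(\mathbb{R})}$ of $V_\alpha$ to $\Delta_\alpha(\mathbb{R})$.
   Context: Notation: $\mathbb{R}^\ast=\mathbb{R}\setminus\{0\}$, $\mathbb{N}=\{0,1,2,\dots\}$, $\frac{d}{dx^2}=\frac{1}{2x}\frac{d}{dx}$. For $a\ge0$, $\mathcal{D}_a(\mathbb{R})$ is the space of infinitely differentiable functions on $\mathbb{R}$ with support in $[-a,a]$, with the topology of the semi-norms $p_n(f)=\sup_{0\le p\le n,\,x\in[-a,a]}|f^{(p)}(x)|$, and $\mathcal{D}(\mathbb{R})=\bigcup_{a\ge0}\mathcal{D}_a(\mathbb{R})$ with the inductive limit topology. Weyl integral: for $f\in\mathcal{D}(\mathbb{R})$ and $y\in\mathbb{R}^\ast$, $W_\alpha f(y)=\frac{2\Gamma(\alpha+1)}{\sqrt{\pi}\,\Gamma(\alpha+\frac12)}\int_{|y|}^{+\infty}(x^2-y^2)^{\alpha-\frac12}\,x\,f(\mathrm{sgn}(y)x)\,dx$. $\mathcal{K}_0$ is the space of functions $f$ infinitely differentiable on $\mathbb{R}^\ast$, with bounded support, such that for every $n\in\mathbb{N}$ the limits $\lim_{y\to0,\,y>0}y^nf^{(n)}(y)$ and $\lim_{y\to0,\,y<0}y^nf^{(n)}(y)$ exist. Operator $V_\alpha$ on $\mathcal{K}_0$: if $\alpha=k+\frac12$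 with $k\in\mathbb{N}$, $V_\alpha f(x)=(-1)^{k+1}\frac{2^{2k+1}k!}{(2k+1)!}\left(\frac{d}{dx^2}\right)^{k+1}f(x)$, $x\in\mathbb{R}^\ast$; if $\alpha=k+r$ with $k\in\mathbb{N}$, $-\frac12<r<\frac12$, $V_\alpha f(x)=c_1\int_{|x|}^{+\infty}(y^2-x^2)^{-r-\frac12}\left(\left(\frac{d}{dy^2}\right)^{k+1}f\right)(\mathrm{sgn}(x)y)\,y\,dy$, $x\in\mathbb{R}^\ast$, with $c_1=\frac{(-1)^{k+1}2\sqrt\pi}{\Gamma(\alpha+1)\Gamma(\frac12-r)}$. When $V_\alpha f$ extends to a smooth function on $\mathbb{R}$, it is identified with this extension. Spaces $\Delta_\alpha(\mathbb{R})$: let $a\ge0$. - If $\alpha=k+\frac12$, $k\in\mathbb{N}$: $\Delta_{a,\alpha}(\mathbb{R})$ is the set of $f\in\mathcal{K}_0$ with support in $[-a,a]$ such that $\left(\frac{d}{dx^2}\right)^{k+1}f$ can be extended to a function belonging to $\mathcal{D}(\mathbb{R})$, topologized by the semi-norms $\rho_n(f)=\sup_{0\le p\le n,\,x\in[-a,a]}\left|\left(\left(\frac{d}{dx^2}\right)^{k+1}f\right)^{(p)}(x)\right|$, $n\in\mathbb{N}$. - If $\alpha=k+r$, $k\in\mathbb{N}$, $-\frac12<r<\frac12$: $\Delta_{a,\alpha}(\mathbb{R})$ is the set of $f\in\mathcal{K}_0$ with support in $[-a,a]$ such that $\left(\frac{d}{dx^2}\right)^{k+1}\left(\int_1^{+\infty}(t^2-1)^{-r-\frac12}f(xt)\,t\,dt\right)$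 can be extended to a function belonging to $|x|^{2r-1}\mathcal{D}(\mathbb{R})$, topologized by the semi-norms $q_n(f)=\sup_{0\le p\le n,\,x\in[-a,a]}\left|\frac{d^p}{dx^p}\left(|x|^{-2r+1}\left(\frac{d}{dx^2}\right)^{k+1}\left(\int_1^{+\infty}(t^2-1)^{-r-\frac12}f(xt)\,t\,dt\right)\right)\right|$, $n\in\mathbb{N}$ (with the extension to $x=0$ understood). In both cases $\Delta_\alpha(\mathbb{R})=\bigcup_{a\ge0}\Delta_{a,\alpha}(\mathbb{R})$ with the inductive limit topology.
   Formalization: For α=k+r with -1/2<r<1/2, in Δ_α(R) and its semi-norms q_n the operator (d/dx²)^{k+1} acts on f inside the integral, evaluated at xt, not on the integral of f(xt); as written the claim fails (e.g. α=0, f≥0 even nonzero). *)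

theory Defs
  imports "HOL-Analysis.Analysis"
begin

text \<open>
  A function on the punctured line is represented by a total function real => complex. Where
  such functions form a space (K0, Delta), or are the values of an operator (Weyl), the
  irrelevant value at 0 is normalised to 0, so that equality of representatives is equality
  of functions on the punctured line.
\<close>

section \<open>Smooth functions and the operator d/dx^2\<close>

definition vderiv :: "(real \<Rightarrow> complex) \<Rightarrow> real \<Rightarrow> complex" where
  "vderiv f x = vector_derivative f (at x)"

text \<open>Only meant for open sets \<open>S\<close>: the derivatives are two-sided.\<close>

definition smooth_on :: "real set \<Rightarrow> (real \<Rightarrow> complex) \<Rightarrow> bool" where
  "smooth_on S f \<longleftrightarrow> (\<forall>n. \<forall>x\<in>S. (vderiv ^^ n) f differentiable at x)"

definition ddx2 :: "(real \<Rightarrow> complex) \<Rightarrow> real \<Rightarrow> complex" where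
  "ddx2 f x = (1 / (2 * x)) *\<^sub>R vderiv f x"

definition fun_support :: "(real \<Rightarrow> complex) \<Rightarrow> real set" where
  "fun_support f = closure {x. f x \<noteq> 0}"

text \<open>
  The smooth extension to the whole line of a function on the punctured line, and the function
  itself if there is none. The value \<open>h 0\<close> plays no role in the first case.
\<close>

definition smooth_extension :: "(real \<Rightarrow> complex) \<Rightarrow> real \<Rightarrow> complex" where
  "smooth_extension h =
    (if \<exists>g. smooth_on UNIV g \<and> (\<forall>x. x \<noteq> 0 \<longrightarrow> g x = h x)
     then THE g. smooth_on UNIV g \<and> (\<forall>x. x \<noteq> 0 \<longrightarrow> g x = h x)
     else h)"

lemma smooth_on_UNIV_isCont:
  assumes "smooth_on UNIV g"
  shows "isCont g x"
proof -
  have "(vderiv ^^ 0) g differentiable at x"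
    using assms unfolding smooth_on_def by blast
  then show ?thesis
    by (simp add: differentiable_imp_continuous_within)
qed

lemma smooth_extension_eqI:
  assumes g: "smooth_on UNIV g" and eq: "\<And>x. x \<noteq> 0 \<Longrightarrow> g x = h x"
  shows "smooth_extension h = g"
proof -
  have uniq: "g' = g" if g': "smooth_on UNIV g'" "\<forall>x. x \<noteq> 0 \<longrightarrow> g' x = h x" for g'
  proof
    fix x
    have "(g' \<longlongrightarrow> g' 0) (at 0)" "(g \<longlongrightarrow> g 0) (at 0)"
      using smooth_on_UNIV_isCont[OF g'(1), of 0] smooth_on_UNIV_isCont[OF g, of 0]
      by (auto simp: isCont_def)
    moreover have "eventually (\<lambda>x. g' x = g x) (at 0)"
      using g'(2) eq by (auto simp: eventually_at_filter)
    ultimately have "g' 0 = g 0"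
      by (metis tendsto_cong tendsto_unique trivial_limit_at)
    then show "g' x = g x"
      using g'(2) eq by (cases "x = 0") auto
  qed
  have "(THE g. smooth_on UNIV g \<and> (\<forall>x. x \<noteq> 0 \<longrightarrow> g x = h x)) = g"
  proof (rule the_equality)
    show "smooth_on UNIV g \<and> (\<forall>x. x \<noteq> 0 \<longrightarrow> g x = h x)"
      using g eq by blast
  qed (use uniq in blast)
  then show ?thesis
    unfolding smooth_extension_def using g eq by (subst if_P) blast+
qed

lemma funpow_vderiv_zero [simp]: "(vderiv ^^ n) (\<lambda>x. 0) = (\<lambda>x. 0)"
proof (induction n)
  case (Suc n)
  have "vderiv (\<lambda>x. 0) = (\<lambda>x. 0)" by (simp add: vderiv_def fun_eq_iff)
  then show ?case using Suc by simp
qed simp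

lemma funpow_ddx2_zero [simp]: "(ddx2 ^^ n) (\<lambda>x. 0) = (\<lambda>x. 0)"
proof (induction n)
  case (Suc n)
  have "ddx2 (\<lambda>x. 0) = (\<lambda>x. 0)" by (simp add: ddx2_def vderiv_def fun_eq_iff)
  then show ?case using Suc by simp
qed simp

lemma smooth_on_zero [simp]: "smooth_on S (\<lambda>x. 0)"
  by (simp add: smooth_on_def)

lemma fun_support_zero [simp]: "fun_support (\<lambda>x. 0) = {}"
  by (simp add: fun_support_def)

section \<open>Locally convex topologies on spaces of functions\<close>

definition seminorm_topology ::
    "(real \<Rightarrow> complex) set \<Rightarrow> (nat \<Rightarrow> (real \<Rightarrow> complex) \<Rightarrow> real) \<Rightarrow> (real \<Rightarrow> complex) topology" where
  "seminorm_topology E p = topology (\<lambda>U. U \<subseteq> E \<and>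
     (\<forall>f\<in>U. \<exists>n. \<exists>\<epsilon>>0. {g\<in>E. \<forall>i\<le>n. p i (\<lambda>x. g x - f x) < \<epsilon>} \<subseteq> U))"

definition absolutely_convex :: "(real \<Rightarrow> complex) set \<Rightarrow> bool" where
  "absolutely_convex U \<longleftrightarrow>
     (\<forall>f\<in>U. \<forall>g\<in>U. \<forall>s t::complex. cmod s + cmod t \<le> 1 \<longrightarrow> (\<lambda>x. s * f x + t * g x) \<in> U)"

definition zero_neighbourhood :: "(real \<Rightarrow> complex) topology \<Rightarrow> (real \<Rightarrow> complex) set \<Rightarrow> bool" where
  "zero_neighbourhood X U \<longleftrightarrow> (\<exists>V. openin X V \<and> (\<lambda>x. 0) \<in> V \<and> V \<subseteq> U)"

text \<open>
  The locally convex inductive limit of the spaces \<open>X a\<close>, \<open>a \<ge> 0\<close>, on the union of their carriers: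
  a fundamental system of neighbourhoods of zero is formed by the absolutely convex sets that
  meet every \<open>X a\<close> in a neighbourhood of zero. (The sets \<open>U\<close> need not be
  contained in the union; only their trace on it matters, and \<open>zero_neighbourhood (X a) U\<close>
  only depends on the trace of \<open>U\<close> on \<open>X a\<close>.)
\<close>

definition inductive_limit_topology ::
    "(real \<Rightarrow> (real \<Rightarrow> complex) topology) \<Rightarrow> (real \<Rightarrow> complex) topology" where
  "inductive_limit_topology X =
     (let E = (\<Union>a\<in>{0..}. topspace (X a)) in
      topology (\<lambda>W. W \<subseteq> E \<and>
        (\<forall>f\<in>W. \<exists>U. absolutely_convex U \<and> (\<forall>a\<ge>0. zero_neighbourhood (X a) U) \<and>
           {g\<in>E. (\<lambda>x. g x - f x) \<in> U} \<subseteq> W)))"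

definition topological_isomorphism ::
    "(real \<Rightarrow> complex) topology \<Rightarrow> (real \<Rightarrow> complex) topology \<Rightarrow>
     ((real \<Rightarrow> complex) \<Rightarrow> real \<Rightarrow> complex) \<Rightarrow> bool" where
  "topological_isomorphism X Y T \<longleftrightarrow>
     (\<forall>f\<in>topspace X. \<forall>g\<in>topspace X. \<forall>s t::complex.
        T (\<lambda>x. s * f x + t * g x) = (\<lambda>x. s * T f x + t * T g x)) \<and>
     homeomorphic_map X Y T"

lemma openin_seminorm_topology:
  "openin (seminorm_topology E p) U \<longleftrightarrow> U \<subseteq> E \<and>
     (\<forall>f\<in>U. \<exists>n. \<exists>\<epsilon>>0. {g\<in>E. \<forall>i\<le>n. p i (\<lambda>x. g x - f x) < \<epsilon>} \<subseteq> U)"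
proof -
  let ?B = "\<lambda>f n \<epsilon>. {g\<in>E. \<forall>i\<le>n. p i (\<lambda>x. g x - f x) < \<epsilon>}"
  let ?P = "\<lambda>U. U \<subseteq> E \<and> (\<forall>f\<in>U. \<exists>n. \<exists>\<epsilon>>0. ?B f n \<epsilon> \<subseteq> U)"
  have "istopology ?P"
    unfolding istopology_def
  proof (intro conjI allI impI)
    fix S T assume S: "?P S" and T: "?P T"
    show "S \<inter> T \<subseteq> E" using S by blast
    show "\<forall>f\<in>S \<inter> T. \<exists>n. \<exists>\<epsilon>>0. ?B f n \<epsilon> \<subseteq> S \<inter> T"
    proof
      fix f assume f: "f \<in> S \<inter> T"
      obtain n d where 1: "d > 0" "?B f n d \<subseteq> S" using S f by blast
      obtain m e where 2: "e > 0" "?B f m e \<subseteq> T" using T f by blast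
      have "?B f (max n m) (min d e) \<subseteq> S \<inter> T" using 1(2) 2(2) by fastforce
      then show "\<exists>n. \<exists>\<epsilon>>0. ?B f n \<epsilon> \<subseteq> S \<inter> T"
        using 1(1) 2(1) by (intro exI[of _ "max n m"] exI[of _ "min d e"]) auto
    qed
  next
    fix K assume K: "\<forall>S\<in>K. ?P S"
    then show "\<Union>K \<subseteq> E" by blast
    show "\<forall>f\<in>\<Union>K. \<exists>n. \<exists>\<epsilon>>0. ?B f n \<epsilon> \<subseteq> \<Union>K"
    proof
      fix f assume "f \<in> \<Union>K"
      then obtain S where S: "S \<in> K" "f \<in> S" by blast
      then obtain n d where "d > 0" "?B f n d \<subseteq> S" using K by blast
      moreover have "S \<subseteq> \<Union>K" using S(1) by (rule Union_upper)
      ultimately show "\<exists>n. \<exists>\<epsilon>>0. ?B f n \<epsilon> \<subseteq> \<Union>K"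
        by (intro exI[of _ n] exI[of _ d] conjI) (auto simp del: Union_iff)
    qed
  qed
  then show ?thesis
    unfolding seminorm_topology_def by (simp add: topology_inverse')
qed

lemma topspace_seminorm_topology [simp]: "topspace (seminorm_topology E p) = E"
proof -
  have "openin (seminorm_topology E p) E"
    unfolding openin_seminorm_topology by (auto intro: exI[of _ "1::real"])
  then show ?thesis
    using openin_subset[of "seminorm_topology E p"] openin_topspace[of "seminorm_topology E p"] iffD1[OF openin_seminorm_topology, THEN conjunct1]
    by (intro subset_antisym)
qed

lemma openin_inductive_limit_topology:
  fixes X :: "real \<Rightarrow> (real \<Rightarrow> complex) topology"
  defines "E \<equiv> \<Union>a\<in>{0..}. topspace (X a)"
  shows "openin (inductive_limit_topology X) W \<longleftrightarrow> W \<subseteq> E \<and>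
    (\<forall>f\<in>W. \<exists>U. absolutely_convex U \<and> (\<forall>a\<ge>0. zero_neighbourhood (X a) U) \<and>
       {g\<in>E. (\<lambda>x. g x - f x) \<in> U} \<subseteq> W)"
proof -
  let ?N = "\<lambda>U. absolutely_convex U \<and> (\<forall>a\<ge>0. zero_neighbourhood (X a) U)"
  let ?B = "\<lambda>f U. {g\<in>E. (\<lambda>x. g x - f x) \<in> U}"
  let ?P = "\<lambda>W. W \<subseteq> E \<and> (\<forall>f\<in>W. \<exists>U. absolutely_convex U \<and> (\<forall>a\<ge>0. zero_neighbourhood (X a) U) \<and> ?B f U \<subseteq> W)"
  have N: "?N (U \<inter> V)" if "?N U" "?N V" for U V
  proof (intro conjI allI impI)
    show "absolutely_convex (U \<inter> V)"
      using that unfolding absolutely_convex_def by blast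
    fix a :: real assume "a \<ge> 0"
    then have "zero_neighbourhood (X a) U" "zero_neighbourhood (X a) V"
      using that by auto
    then obtain A B where "openin (X a) A" "(\<lambda>x. 0) \<in> A" "A \<subseteq> U"
      "openin (X a) B" "(\<lambda>x. 0) \<in> B" "B \<subseteq> V"
      unfolding zero_neighbourhood_def by blast
    then show "zero_neighbourhood (X a) (U \<inter> V)"
      unfolding zero_neighbourhood_def by (intro exI[of _ "A \<inter> B"]) auto
  qed
  have "istopology ?P"
    unfolding istopology_def
  proof (intro conjI allI impI)
    fix S T assume S: "?P S" and T: "?P T"
    show "S \<inter> T \<subseteq> E" using S by blast
    show "\<forall>f\<in>S \<inter> T. \<exists>U. absolutely_convex U \<and> (\<forall>a\<ge>0. zero_neighbourhood (X a) U) \<and> ?B f U \<subseteq> S \<inter> T"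
    proof
      fix f assume f: "f \<in> S \<inter> T"
      obtain U where 1: "?N U" "?B f U \<subseteq> S" using S f by blast
      obtain V where 2: "?N V" "?B f V \<subseteq> T" using T f by blast
      have "?B f (U \<inter> V) \<subseteq> S \<inter> T" using 1(2) 2(2) by blast
      then show "\<exists>U. absolutely_convex U \<and> (\<forall>a\<ge>0. zero_neighbourhood (X a) U) \<and> ?B f U \<subseteq> S \<inter> T"
        using N[OF 1(1) 2(1)] by (intro exI[of _ "U \<inter> V"]) simp
    qed
  next
    fix K assume K: "\<forall>S\<in>K. ?P S"
    then show "\<Union>K \<subseteq> E" by blast
    show "\<forall>f\<in>\<Union>K. \<exists>U. absolutely_convex U \<and> (\<forall>a\<ge>0. zero_neighbourhood (X a) U) \<and> ?B f U \<subseteq> \<Union>K"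
    proof
      fix f assume "f \<in> \<Union>K"
      then obtain S where S: "S \<in> K" "f \<in> S" by blast
      then obtain U where "absolutely_convex U" "\<forall>a\<ge>0. zero_neighbourhood (X a) U" "?B f U \<subseteq> S"
        using K by blast
      moreover have "S \<subseteq> \<Union>K" using S(1) by (rule Union_upper)
      ultimately show "\<exists>U. absolutely_convex U \<and> (\<forall>a\<ge>0. zero_neighbourhood (X a) U) \<and> ?B f U \<subseteq> \<Union>K"
        by (intro exI[of _ U] conjI) (assumption, assumption, rule subset_trans)
    qed
  qed
  then show ?thesis
    unfolding inductive_limit_topology_def Let_def E_def[symmetric]
    by (simp add: topology_inverse')
qed

lemma topspace_inductive_limit_topology:
  assumes zero: "\<And>a. a \<ge> 0 \<Longrightarrow> (\<lambda>x. 0) \<in> topspace (X a)"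
  shows "topspace (inductive_limit_topology X) = (\<Union>a\<in>{0..}. topspace (X a))" (is "_ = ?E")
proof -
  have "absolutely_convex UNIV" "\<forall>a\<ge>0. zero_neighbourhood (X a) UNIV"
    using zero unfolding absolutely_convex_def zero_neighbourhood_def by auto
  then have "openin (inductive_limit_topology X) ?E"
    unfolding openin_inductive_limit_topology by (auto intro: exI[of _ UNIV])
  then show ?thesis
    using openin_subset[of "inductive_limit_topology X"] openin_topspace[of "inductive_limit_topology X"] iffD1[OF openin_inductive_limit_topology, THEN conjunct1]
    by (intro subset_antisym)
qed

section \<open>Test functions\<close>

definition test_functions_on :: "real \<Rightarrow> (real \<Rightarrow> complex) set" where
  "test_functions_on a = {f. smooth_on UNIV f \<and> fun_support f \<subseteq> {-a..a}}"

definition test_functions :: "(real \<Rightarrow> complex) set" where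
  "test_functions = (\<Union>a\<in>{0..}. test_functions_on a)"

definition sup_deriv :: "real \<Rightarrow> nat \<Rightarrow> (real \<Rightarrow> complex) \<Rightarrow> real" where
  "sup_deriv a n f = (SUP (p, x) \<in> {..n} \<times> {-a..a}. cmod ((vderiv ^^ p) f x))"

definition test_topology :: "(real \<Rightarrow> complex) topology" where
  "test_topology =
     inductive_limit_topology (\<lambda>a. seminorm_topology (test_functions_on a) (sup_deriv a))"

lemma topspace_test_topology: "topspace test_topology = test_functions"
  unfolding test_topology_def test_functions_def
  by (subst topspace_inductive_limit_topology) (auto simp: test_functions_on_def)

section \<open>The operators\<close>

definition Weyl :: "real \<Rightarrow> (real \<Rightarrow> complex) \<Rightarrow> real \<Rightarrow> complex" where
  "Weyl \<alpha> f y = (if y = 0 then 0 else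
     (2 * Gamma (\<alpha> + 1) / (sqrt pi * Gamma (\<alpha> + 1/2))) *\<^sub>R
     (LBINT x:{\<bar>y\<bar>..}. ((x\<^sup>2 - y\<^sup>2) powr (\<alpha> - 1/2) * x) *\<^sub>R f (sgn y * x)))"

definition K0 :: "(real \<Rightarrow> complex) set" where
  "K0 = {f. f 0 = 0 \<and> smooth_on (- {0}) f \<and> bounded (fun_support f) \<and>
     (\<forall>n. (\<exists>l. ((\<lambda>y. y ^ n *\<^sub>R (vderiv ^^ n) f y) \<longlongrightarrow> l) (at_right 0)) \<and>
          (\<exists>l. ((\<lambda>y. y ^ n *\<^sub>R (vderiv ^^ n) f y) \<longlongrightarrow> l) (at_left 0)))}"

text \<open>
  The decomposition \<open>\<alpha> = k + r\<close> with \<open>k\<close> a natural number and \<open>-1/2 < r \<le> 1/2\<close>. The case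
  \<open>\<alpha> = k + 1/2\<close> is \<open>r = 1/2\<close>.
\<close>

definition index_k :: "real \<Rightarrow> nat" where
  "index_k \<alpha> = nat \<lceil>\<alpha> - 1/2\<rceil>"

definition index_r :: "real \<Rightarrow> real" where
  "index_r \<alpha> = \<alpha> - real (index_k \<alpha>)"

lemma index_decomposition:
  assumes "-1/2 < r" "r \<le> 1/2"
  shows "index_k (real k + r) = k" "index_r (real k + r) = r"
proof -
  have "\<lceil>real k + r - 1/2\<rceil> = int k"
    using assms by (intro ceiling_unique) auto
  then show "index_k (real k + r) = k"
    by (simp add: index_k_def)
  then show "index_r (real k + r) = r"
    by (simp add: index_r_def)
qed

lemma index_r_bounds:
  assumes "\<alpha> > -1/2"
  shows "-1/2 < index_r \<alpha>" "index_r \<alpha> \<le> 1/2" "\<alpha> = real (index_k \<alpha>) + index_r \<alpha>"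
proof -
  have "\<lceil>\<alpha> - 1/2\<rceil> \<ge> 0" using assms by linarith
  then have "real (index_k \<alpha>) = real_of_int \<lceil>\<alpha> - 1/2\<rceil>"
    by (simp add: index_k_def)
  then show "-1/2 < index_r \<alpha>" "index_r \<alpha> \<le> 1/2" "\<alpha> = real (index_k \<alpha>) + index_r \<alpha>"
    unfolding index_r_def by linarith+
qed

definition inverse_Weyl :: "real \<Rightarrow> (real \<Rightarrow> complex) \<Rightarrow> real \<Rightarrow> complex" where
  "inverse_Weyl \<alpha> f =
    (let k = index_k \<alpha>; r = index_r \<alpha> in
     smooth_extension (\<lambda>x.
       if r = 1/2 then
         ((-1) ^ (k + 1) * (2 ^ (2 * k + 1) * fact k / fact (2 * k + 1))) *\<^sub>R (ddx2 ^^ (k + 1)) f x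
       else
         ((-1) ^ (k + 1) * 2 * sqrt pi / (Gamma (\<alpha> + 1) * Gamma (1/2 - r))) *\<^sub>R
         (LBINT y:{\<bar>x\<bar>..}. ((y\<^sup>2 - x\<^sup>2) powr (- r - 1/2) * y) *\<^sub>R
            (ddx2 ^^ (k + 1)) f (sgn x * y))))"

section \<open>The range spaces\<close>

text \<open>
  The function on the punctured line which defines \<open>Delta\<close> and its topology, for \<open>r = 1/2\<close> the
  iterate \<open>(d/dx^2)^(k+1) f\<close>. For \<open>r < 1/2\<close> the function to be taken in \<open>|x|^(2r-1) D(R)\<close> is
  \<open>Delta_integral\<close>. In it the operator \<open>(d/dx^2)^(k+1)\<close> is applied to \<open>f\<close>, and the result is
  evaluated at \<open>x t\<close>, exactly as in the integral defining \<open>inverse_Weyl\<close>, to which it is related by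
  the substitution \<open>y = |x| t\<close>. Pulling the operator out of the integral without its chain rule
  factor \<open>t^(2k+2)\<close>, that is iterating \<open>d/dx^2\<close> on the integral of \<open>(t^2-1)^(-r-1/2) f (x t) t\<close>,
  gives a different condition, which the image of a test function need not satisfy: for
  \<open>\<alpha> = 0\<close> and \<open>f \<ge> 0\<close> even and nonzero it would force the integral of \<open>Weyl 0 f (x t)\<close> to stay bounded
  as \<open>x\<close> tends to 0, whereas it grows like \<open>1/|x|\<close>.
\<close>

definition Delta_integral :: "real \<Rightarrow> (real \<Rightarrow> complex) \<Rightarrow> real \<Rightarrow> complex" where
  "Delta_integral \<alpha> f x =
     (LBINT t:{1..}. ((t\<^sup>2 - 1) powr (- index_r \<alpha> - 1/2) * t) *\<^sub>R
        (ddx2 ^^ (index_k \<alpha> + 1)) f (x * t))"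

definition Delta_on :: "real \<Rightarrow> real \<Rightarrow> (real \<Rightarrow> complex) set" where
  "Delta_on \<alpha> a = {f \<in> K0. fun_support f \<subseteq> {-a..a} \<and>
     (\<exists>\<phi>\<in>test_functions. \<forall>x. x \<noteq> 0 \<longrightarrow>
        (if index_r \<alpha> = 1/2 then (ddx2 ^^ (index_k \<alpha> + 1)) f x = \<phi> x
         else Delta_integral \<alpha> f x = (\<bar>x\<bar> powr (2 * index_r \<alpha> - 1)) *\<^sub>R \<phi> x))}"

definition Delta :: "real \<Rightarrow> (real \<Rightarrow> complex) set" where
  "Delta \<alpha> = (\<Union>a\<in>{0..}. Delta_on \<alpha> a)"

definition Delta_seminorm :: "real \<Rightarrow> real \<Rightarrow> nat \<Rightarrow> (real \<Rightarrow> complex) \<Rightarrow> real" where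
  "Delta_seminorm \<alpha> a n f = sup_deriv a n (smooth_extension
     (if index_r \<alpha> = 1/2 then (ddx2 ^^ (index_k \<alpha> + 1)) f
      else (\<lambda>x. (\<bar>x\<bar> powr (1 - 2 * index_r \<alpha>)) *\<^sub>R Delta_integral \<alpha> f x)))"

definition Delta_topology :: "real \<Rightarrow> (real \<Rightarrow> complex) topology" where
  "Delta_topology \<alpha> =
     inductive_limit_topology (\<lambda>a. seminorm_topology (Delta_on \<alpha> a) (Delta_seminorm \<alpha> a))"

lemma zero_in_Delta_on:
  assumes "a \<ge> 0"
  shows "(\<lambda>x. 0) \<in> Delta_on \<alpha> a"
proof -
  have "(\<lambda>x. 0) \<in> test_functions"
    unfolding test_functions_def test_functions_on_def by auto
  moreover have "(\<lambda>x. 0) \<in> K0"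
    by (auto simp: K0_def)
  moreover have "Delta_integral \<alpha> (\<lambda>x. 0) x = 0" for x
    by (simp add: Delta_integral_def set_lebesgue_integral_def del: funpow.simps)
  ultimately show ?thesis
    unfolding Delta_on_def by (auto simp del: funpow.simps intro!: bexI[of _ "\<lambda>x. 0"])
qed

lemma topspace_Delta_topology: "topspace (Delta_topology \<alpha>) = Delta \<alpha>"
  unfolding Delta_topology_def Delta_def
  by (subst topspace_inductive_limit_topology) (auto simp: zero_in_Delta_on)

end

theory Submission
  imports Defs
begin

text \<open>
  In the variable \<open>u = x\<^sup>2\<close> the operator \<open>d/dx^2\<close> is \<open>d/du\<close> and, on each half-line, \<open>Weyl \<alpha>\<close> is a
  positive multiple of the fractional integral \<open>I\<^sup>\<beta>\<close> of order \<open>\<beta> = \<alpha> + 1/2\<close>. Fractional integrals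
  commute with \<open>d/du\<close> and form a semigroup, so that with \<open>\<alpha> = k + r\<close> and \<open>D = d/du\<close> both
  \<open>I^(1/2-r) D^(k+1) I\<^sup>\<beta>\<close> and \<open>I\<^sup>\<beta> I^(1/2-r) D^(k+1)\<close> equal \<open>I^(k+1) D^(k+1) = (-1)^(k+1)\<close>.
  Homogeneity of \<open>Weyl \<alpha>\<close> gives \<open>y^n (d/dy)^n (Weyl \<alpha> f) = Weyl \<alpha> f\<^sub>n\<close> with test functions \<open>f\<^sub>n\<close>,
  hence the range is contained in \<open>K0\<close>. The transform maps test functions supported in \<open>[-a, a]\<close> onto
  \<open>Delta_on \<alpha> a\<close> and multiplies the seminorms by one constant, and such a map between inductive
  limits is a homeomorphism.
\<close>


section \<open>Fractional integrals on a half-line\<close>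

text \<open>The singular kernel is never differentiated, and no derivative is taken under the
  integral sign: the semigroup law with order 1 gives I^\<beta> g = - I^1 I^\<beta> g', and I^1 is
  governed by the fundamental theorem of calculus. The obstacle is the origin. A test function folds
  to a function of u that is continuous at u = 0, but its u-derivatives are in general singular
  there. Identities with derivatives are therefore confined to u > 0, and on u \<ge> 0 only
  continuity of the integral is available. For the same reason the limits demanded by
  \<open>K0\<close> are reached through the operators c + x d/dx, which keep test functions smooth
  across the origin, and not through d/dx^2. As the kernels are unnormalised, the semigroup law
  holds up to a \<open>Beta\<close> factor. These factors, the k! of order k + 1 and the constant of
  \<open>Weyl\<close> make up \<open>Weyl_inverse_factor\<close>. The two compositions have
  different uses: V after \<open>Weyl\<close> yields injectivity, the seminorm identity and the
  formula for the inverse; \<open>Weyl\<close> after V yields surjectivity.\<close>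

text \<open>Up to the factor \<open>1 / Gamma \<beta>\<close>, the Weyl fractional integral of order \<open>\<beta>\<close>.\<close>

definition frac_integral :: "real \<Rightarrow> (real \<Rightarrow> complex) \<Rightarrow> real \<Rightarrow> complex" where
  "frac_integral \<beta> g v = (LBINT s:{0<..}. (s powr (\<beta> - 1)) *\<^sub>R g (v + s))"

text \<open>The set is a parameter because iterates of d/du are controlled only on
  \<open>{0<..}\<close>, while uniform bounds need a closed half-line \<open>{c..}\<close>. Values
  to the left of it are arbitrary: the integral at v sees only v + s with s > 0.\<close>

definition eventually_zero_cts :: "real set \<Rightarrow> (real \<Rightarrow> complex) \<Rightarrow> bool" where
  "eventually_zero_cts S g \<longleftrightarrow> continuous_on S g \<and> (\<exists>A. \<forall>u\<ge>A. g u = 0)"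

section \<open>Integrability, and continuity in the base point\<close>

lemma eventually_zero_cts_subset:
  "eventually_zero_cts S g \<Longrightarrow> T \<subseteq> S \<Longrightarrow> eventually_zero_cts T g"
  unfolding eventually_zero_cts_def using continuous_on_subset by blast

lemma eventually_zero_cts_bound:
  assumes "eventually_zero_cts {c..} g"
  obtains A M where "\<And>u. u \<ge> c \<Longrightarrow> norm (g u) \<le> M" "\<And>u. u \<ge> A \<Longrightarrow> g u = 0" "A > c" "M > 0"
proof -
  obtain A0 where A0: "\<And>u. u \<ge> A0 \<Longrightarrow> g u = 0" and g: "continuous_on {c..} g"
    using assms unfolding eventually_zero_cts_def by blast
  define A where "A = max A0 (c + 1)"
  have "compact (g ` {c..A})"
    by (intro compact_continuous_image continuous_on_subset[OF g]) auto
  then obtain M where M: "M > 0" "\<forall>z\<in>g ` {c..A}. norm z \<le> M"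
    using bounded_pos compact_imp_bounded by metis
  show ?thesis
  proof
    show "norm (g u) \<le> M" if "u \<ge> c" for u
      using that A0[of u] M by (cases "u \<le> A") (auto simp: A_def)
    show "A > c" by (simp add: A_def)
  qed (use A0 M in \<open>auto simp: A_def\<close>)
qed

text \<open>Carries explicit gauge integrals (powers, the Beta integral) over to Lebesgue integrals;
  nonnegativity turns integrability into absolute integrability.\<close>

lemma has_bochner_integral_lborel_nonneg:
  fixes f :: "real \<Rightarrow> real"
  assumes "f \<in> borel_measurable borel" "\<And>x. 0 \<le> f x" "(f has_integral I) UNIV"
  shows "has_bochner_integral lborel f I"
proof (rule has_bochner_integral_nn_integral)
  show "integral\<^sup>N lborel f = ennreal I"
    by (rule nn_integral_has_integral_lborel) fact+
  show "0 \<le> I"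
    using has_integral_nonneg[OF assms(3)] assms(2) by blast
qed (use assms in auto)

lemma integrable_powr_Ioc:
  fixes \<beta> c :: real
  assumes "\<beta> > 0" "c \<ge> 0"
  shows "integrable lborel (\<lambda>s. indicator {0<..c} s * s powr (\<beta> - 1))"
proof -
  have "((\<lambda>s. s powr (\<beta> - 1)) has_integral (c powr (\<beta> - 1 + 1) / (\<beta> - 1 + 1))) {0..c}"
    using assms by (intro has_integral_powr_from_0) auto
  then have "((\<lambda>s. if s \<in> {0..c} then s powr (\<beta> - 1) else 0) has_integral (c powr (\<beta> - 1 + 1) / (\<beta> - 1 + 1))) UNIV"
    by (simp only: has_integral_restrict_UNIV)
  also have "(\<lambda>s. if s \<in> {0..c} then s powr (\<beta> - 1) else 0) = (\<lambda>s. indicator {0<..c} s * s powr (\<beta> - 1))"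
    by (auto simp: fun_eq_iff indicator_def)
  finally have "has_bochner_integral lborel (\<lambda>s. indicator {0<..c} s * s powr (\<beta> - 1)) (c powr (\<beta> - 1 + 1) / (\<beta> - 1 + 1))"
    by (intro has_bochner_integral_lborel_nonneg) auto
  then show ?thesis by (simp add: has_bochner_integral_iff)
qed

lemma measurable_shift_powr:
  fixes g :: "real \<Rightarrow> complex" and \<beta> v :: real
  assumes "continuous_on {c..} g" "v \<ge> c"
  shows "(\<lambda>s. indicator {0<..} s *\<^sub>R ((s powr (\<beta> - 1)) *\<^sub>R g (v + s))) \<in> borel_measurable borel"
proof (rule borel_measurable_continuous_on_indicator)
  show "continuous_on {0<..} (\<lambda>s. (s powr (\<beta> - 1)) *\<^sub>R g (v + s))"
    using assms(2)
    by (intro continuous_intros continuous_on_compose2[OF assms(1)]) auto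
qed auto

text \<open>One majorant serves all v \<ge> c, as dominated convergence requires. It lives on s
  \<le> A - c because v + s \<ge> A for larger s.\<close>

lemma frac_integrand_bound:
  fixes \<beta> :: real
  assumes "eventually_zero_cts {c..} g" "\<beta> > 0"
  obtains w where "integrable lborel w"
    "\<And>v s. v \<ge> c \<Longrightarrow> norm (indicator {0<..} s *\<^sub>R ((s powr (\<beta> - 1)) *\<^sub>R g (v + s))) \<le> w s"
proof -
  obtain M A where AM: "\<And>u. u \<ge> c \<Longrightarrow> norm (g u) \<le> M" "\<And>u. u \<ge> A \<Longrightarrow> g u = 0" "A > c" "M > 0"
    using eventually_zero_cts_bound[OF assms(1)] by metis
  define w where "w s = M * (indicator {0<..A - c} s * s powr (\<beta> - 1))" for s
  show ?thesis
  proof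
    show "integrable lborel w"
      unfolding w_def using assms(2) AM by (intro integrable_mult_right integrable_powr_Ioc) auto
    fix v s :: real assume "v \<ge> c"
    then show "norm (indicator {0<..} s *\<^sub>R ((s powr (\<beta> - 1)) *\<^sub>R g (v + s))) \<le> w s"
      using AM(1)[of "v + s"] AM(2)[of "v + s"] AM(4)
      by (auto simp: w_def indicator_def mult.commute intro: mult_left_mono)
  qed
qed

lemma frac_integrand_integrable:
  fixes \<beta> :: real
  assumes "eventually_zero_cts {c..} g" "\<beta> > 0" "v \<ge> c"
  shows "integrable lborel (\<lambda>s. indicator {0<..} s *\<^sub>R ((s powr (\<beta> - 1)) *\<^sub>R g (v + s)))"
proof -
  obtain w where w: "integrable lborel w"
    "\<And>v s. v \<ge> c \<Longrightarrow> norm (indicator {0<..} s *\<^sub>R ((s powr (\<beta> - 1)) *\<^sub>R g (v + s))) \<le> w s"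
    using frac_integrand_bound[OF assms(1,2)] by metis
  have cont: "continuous_on {c..} g" using assms(1) by (simp add: eventually_zero_cts_def)
  show ?thesis
  proof (rule Bochner_Integration.integrable_bound[OF w(1)])
    show "AE s in lborel. norm (indicator {0<..} s *\<^sub>R ((s powr (\<beta> - 1)) *\<^sub>R g (v + s))) \<le> norm (w s)"
      using order_trans[OF w(2)[OF assms(3)] abs_ge_self] unfolding real_norm_def by blast
    show "(\<lambda>s. indicator {0<..} s *\<^sub>R ((s powr (\<beta> - 1)) *\<^sub>R g (v + s))) \<in> borel_measurable lborel"
      using measurable_shift_powr[OF cont assms(3)] by simp
  qed
qed

text \<open>The endpoint c is included: c = 0 later gives the one-sided limits of the Weyl transform
  at the origin.\<close>

lemma continuous_on_frac_integral:
  assumes g: "eventually_zero_cts {c..} g" and "\<beta> > 0"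
  shows "continuous_on {c..} (frac_integral \<beta> g)"
  unfolding continuous_on_sequentially
proof (intro allI ballI impI, elim conjE)
  fix x a assume x: "a \<in> {c..}" "\<forall>n. x n \<in> {c..}" "x \<longlonglongrightarrow> a"
  obtain w where w: "integrable lborel w"
    "\<And>v s. v \<ge> c \<Longrightarrow> norm (indicator {0<..} s *\<^sub>R ((s powr (\<beta> - 1)) *\<^sub>R g (v + s))) \<le> w s"
    using frac_integrand_bound[OF assms] by metis
  have cont: "continuous_on {c..} g" using g by (simp add: eventually_zero_cts_def)
  show "(frac_integral \<beta> g \<circ> x) \<longlonglongrightarrow> frac_integral \<beta> g a"
    unfolding frac_integral_def o_def set_lebesgue_integral_def
  proof (rule integral_dominated_convergence[where w = w])
    show "AE s in lborel. (\<lambda>i. indicator {0<..} s *\<^sub>R ((s powr (\<beta> - 1)) *\<^sub>R g (x i + s)))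
        \<longlonglongrightarrow> indicator {0<..} s *\<^sub>R ((s powr (\<beta> - 1)) *\<^sub>R g (a + s))"
    proof (rule AE_I2)
      fix s :: real
      show "(\<lambda>i. indicator {0<..} s *\<^sub>R ((s powr (\<beta> - 1)) *\<^sub>R g (x i + s)))
        \<longlonglongrightarrow> indicator {0<..} s *\<^sub>R ((s powr (\<beta> - 1)) *\<^sub>R g (a + s))"
      proof (cases "s > 0")
        case True
        have "(\<lambda>i. g (x i + s)) \<longlonglongrightarrow> g (a + s)"
        proof (rule continuous_on_tendsto_compose[OF cont])
          have "c \<le> x i + s" for i using x(2) True by (simp add: add_increasing2)
          then show "\<forall>\<^sub>F i in sequentially. x i + s \<in> {c..}" by simp
          show "(\<lambda>i. x i + s) \<longlonglongrightarrow> a + s" by (intro tendsto_intros x)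
        qed (use x True in \<open>auto\<close>)
        then show ?thesis by (intro tendsto_intros)
      qed auto
    qed
    show "(\<lambda>s. indicator {0<..} s *\<^sub>R ((s powr (\<beta> - 1)) *\<^sub>R g (a + s))) \<in> borel_measurable lborel"
      "(\<lambda>s. indicator {0<..} s *\<^sub>R ((s powr (\<beta> - 1)) *\<^sub>R g (x i + s))) \<in> borel_measurable lborel" for i
      using measurable_shift_powr[OF cont] x by (simp_all del: scaleR_scaleR)
    show "AE s in lborel. norm (indicator {0<..} s *\<^sub>R ((s powr (\<beta> - 1)) *\<^sub>R g (x i + s))) \<le> w s" for i
      using w(2)[of "x i"] x by simp
  qed (rule w)
qed

lemma eventually_zero_cts_frac_integral:
  assumes "eventually_zero_cts {c..} g" "\<beta> > 0"
  shows "eventually_zero_cts {c..} (frac_integral \<beta> g)"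
proof -
  obtain A where A: "\<forall>u\<ge>A. g u = 0" using assms unfolding eventually_zero_cts_def by blast
  have "frac_integral \<beta> g u = 0" if "u \<ge> A" for u
  proof -
    have *: "indicator {0<..} s *\<^sub>R (s powr (\<beta> - 1) *\<^sub>R g (u + s)) = 0" for s
      using A that by (auto simp: indicator_def)
    show ?thesis unfolding frac_integral_def set_lebesgue_integral_def * by simp
  qed
  then show ?thesis
    using continuous_on_frac_integral[OF assms] unfolding eventually_zero_cts_def by blast
qed

lemma frac_integral_cong:
  assumes "\<And>u. u > v \<Longrightarrow> g u = h u"
  shows "frac_integral \<beta> g v = frac_integral \<beta> h v"
  unfolding frac_integral_def
  by (rule set_lebesgue_integral_cong) (auto simp: assms)

section \<open>The semigroup law\<close>

lemma has_bochner_integral_beta_kernel: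
  fixes \<beta> \<gamma> w :: real
  assumes "\<beta> > 0" "\<gamma> > 0" "w > 0"
  shows "has_bochner_integral lborel
    (\<lambda>s. indicator {0<..<w} s * (s powr (\<beta> - 1) * (w - s) powr (\<gamma> - 1)))
    (w powr (\<beta> + \<gamma> - 1) * Beta \<beta> \<gamma>)"
proof -
  have "((\<lambda>t. if t \<in> {0..1} then t powr (\<beta> - 1) * (1 - t) powr (\<gamma> - 1) else 0) has_integral Beta \<beta> \<gamma>) UNIV"
    using has_integral_Beta_real[OF assms(1,2)] by (simp only: has_integral_restrict_UNIV)
  also have "(\<lambda>t. if t \<in> {0..1} then t powr (\<beta> - 1) * (1 - t) powr (\<gamma> - 1) else 0)
      = (\<lambda>t. indicator {0<..<1} t * (t powr (\<beta> - 1) * (1 - t) powr (\<gamma> - 1)))"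
    by (auto simp: fun_eq_iff indicator_def)
  finally have "has_bochner_integral lborel
      (\<lambda>t. indicator {0<..<1} t * (t powr (\<beta> - 1) * (1 - t) powr (\<gamma> - 1))) (Beta \<beta> \<gamma>)"
    by (intro has_bochner_integral_lborel_nonneg) auto
  \<comment> \<open>Substitution s = w t: the two powers contribute w^(\<beta> + \<gamma> - 2), and
    ds contributes one more w.\<close>
  then have "has_bochner_integral lborel
      (\<lambda>t. w powr (\<beta> + \<gamma> - 2) * (indicator {0<..<1} t * (t powr (\<beta> - 1) * (1 - t) powr (\<gamma> - 1))))
      (w powr (\<beta> + \<gamma> - 2) * Beta \<beta> \<gamma>)"
    by (rule has_bochner_integral_mult_right)
  also have "(\<lambda>t. w powr (\<beta> + \<gamma> - 2) * (indicator {0<..<1} t * (t powr (\<beta> - 1) * (1 - t) powr (\<gamma> - 1))))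
     = (\<lambda>t. indicator {0<..<w} (0 + w * t) * ((0 + w * t) powr (\<beta> - 1) * (w - (0 + w * t)) powr (\<gamma> - 1)))"
  proof
    fix t :: real
    show "w powr (\<beta> + \<gamma> - 2) * (indicator {0<..<1} t * (t powr (\<beta> - 1) * (1 - t) powr (\<gamma> - 1)))
     = indicator {0<..<w} (0 + w * t) * ((0 + w * t) powr (\<beta> - 1) * (w - (0 + w * t)) powr (\<gamma> - 1))"
    proof (cases "t \<in> {0<..<1}")
      case True
      have "(w - w * t) = w * (1 - t)" by (simp add: algebra_simps)
      moreover have "w powr (\<beta> + \<gamma> - 2) = w powr (\<beta> - 1) * w powr (\<gamma> - 1)"
        by (simp flip: powr_add)
      ultimately show ?thesis using True assms(3) by (simp add: powr_mult indicator_def)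
    next
      case False
      then have "w * t \<notin> {0<..<w}" using assms(3) by (auto simp: zero_less_mult_iff)
      then show ?thesis using False by simp
    qed
  qed
  also have "w powr (\<beta> + \<gamma> - 2) * Beta \<beta> \<gamma> = (w powr (\<beta> + \<gamma> - 1) * Beta \<beta> \<gamma>) /\<^sub>R \<bar>w\<bar>"
  proof -
    have "w powr (\<beta> + \<gamma> - 2) = w powr (\<beta> + \<gamma> - 1 - 1)" by (simp add: algebra_simps)
    also have "\<dots> = w powr (\<beta> + \<gamma> - 1) / w" using assms(3) by (subst powr_diff) simp
    finally show ?thesis using assms(3) by (simp add: field_simps)
  qed
  finally show ?thesis
    using assms(3) by (subst (asm) lborel_has_bochner_integral_real_affine_iff[symmetric]) auto
qed

text \<open>In the variables s and w = s + t the iterated integral integrates g (v + w) against a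
  convolution of two power kernels. Fubini isolates that convolution, which is a Beta
  integral.\<close>

lemma frac_integral_frac_integral:
  assumes g: "eventually_zero_cts {c..} g" and pos: "\<beta> > 0" "\<gamma> > 0" and v: "v \<ge> c"
  shows "frac_integral \<beta> (frac_integral \<gamma> g) v = Beta \<beta> \<gamma> *\<^sub>R frac_integral (\<beta> + \<gamma>) g v"
proof -
  \<comment> \<open>The indicator encodes the triangle 0 < s < w, which is the quadrant s, t > 0 in
    the new variables. In \<open>F\<close> the variable w comes first, so that Fubini's criterion
    integrates over s first.\<close>
  define k where "k s w = indicator {0<..<w} s * (s powr (\<beta> - 1) * (w - s) powr (\<gamma> - 1))" for s w :: real
  define h where "h w = indicator {0<..} w *\<^sub>R g (v + w)" for w :: real
  define F where "F w s = k s w *\<^sub>R h w" for w s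
  have h_meas [measurable]: "h \<in> borel_measurable borel"
  proof -
    have "continuous_on {0<..} (\<lambda>w. g (v + w))"
      using v by (intro continuous_intros continuous_on_compose2[OF g[unfolded eventually_zero_cts_def, THEN conjunct1]]) auto
    then show ?thesis unfolding h_def by (intro borel_measurable_continuous_on_indicator) auto
  qed
  have F_meas: "case_prod F \<in> borel_measurable (lborel \<Otimes>\<^sub>M lborel)"
    unfolding F_def k_def indicator_def greaterThanLessThan_iff by measurable
  have k: "has_bochner_integral lborel (\<lambda>s. k s w) (w powr (\<beta> + \<gamma> - 1) * Beta \<beta> \<gamma>)" if "w > 0" for w
    unfolding k_def using has_bochner_integral_beta_kernel[OF pos that] .
  have k_nonneg: "k s w \<ge> 0" for s w by (simp add: k_def)
  have h0: "h w = 0" if "w \<le> 0" for w using that by (simp add: h_def)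
  have inner: "integrable lborel (F w)" for w
  proof (cases "w > 0")
    case True
    then show ?thesis using k[OF True] unfolding F_def has_bochner_integral_iff
      by (intro integrable_scaleR_left) auto
  qed (simp add: F_def[abs_def] h0)
  \<comment> \<open>Because \<open>k\<close> is nonnegative, the norm passes to g, and what remains
    is the norm of an integrand of the same kind of order \<beta> + \<gamma>.\<close>
  have norm_inner: "(LBINT s. norm (F w s)) =
      Beta \<beta> \<gamma> * norm (indicator {0<..} w *\<^sub>R ((w powr (\<beta> + \<gamma> - 1)) *\<^sub>R g (v + w)))" for w
  proof (cases "w > 0")
    case True
    have "(LBINT s. norm (F w s)) = (LBINT s. k s w * norm (h w))"
      by (simp add: F_def k_nonneg)
    also have "\<dots> = w powr (\<beta> + \<gamma> - 1) * Beta \<beta> \<gamma> * norm (h w)"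
      using k[OF True] by (simp add: has_bochner_integral_iff)
    finally show ?thesis using True by (simp add: h_def)
  qed (simp add: F_def h0)
  have F_int: "integrable (lborel \<Otimes>\<^sub>M lborel) (case_prod F)"
  proof (rule lborel_pair.Fubini_integrable[OF F_meas])
    show "integrable lborel (\<lambda>w. LBINT s. norm (case_prod F (w, s)))"
      unfolding prod.case norm_inner
      using pos by (intro integrable_mult_right integrable_norm frac_integrand_integrable[OF g _ v]) auto
  qed (simp add: inner)
  have "frac_integral \<beta> (frac_integral \<gamma> g) v = (LBINT s. LBINT w. F w s)"
    unfolding frac_integral_def[of \<beta>] set_lebesgue_integral_def
  proof (rule Bochner_Integration.integral_cong[OF refl])
    fix s :: real
    show "indicator {0<..} s *\<^sub>R (s powr (\<beta> - 1) *\<^sub>R frac_integral \<gamma> g (v + s)) = (LBINT w. F w s)"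
    proof (cases "s > 0")
      case True
      \<comment> \<open>Translation w = s + t at fixed s recovers the inner fractional integral at v
        + s.\<close>
      have "(LBINT w. F w s) = (LBINT t. F (s + 1 * t) s)"
        by (subst lborel_integral_real_affine[where c = 1 and t = s]) auto
      also have "\<dots> = (LBINT t. (s powr (\<beta> - 1)) *\<^sub>R (indicator {0<..} t *\<^sub>R (t powr (\<gamma> - 1) *\<^sub>R g (v + s + t))))"
        using True by (intro Bochner_Integration.integral_cong[OF refl])
          (auto simp: F_def k_def h_def indicator_def add.assoc)
      also have "\<dots> = (s powr (\<beta> - 1)) *\<^sub>R frac_integral \<gamma> g (v + s)"
        unfolding frac_integral_def set_lebesgue_integral_def by (rule integral_scaleR_right)
      finally show ?thesis using True by simp
    qed (simp add: F_def k_def)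
  qed
  also have "\<dots> = (LBINT w. LBINT s. F w s)"
    by (rule lborel_pair.Fubini_integral[OF F_int])
  also have "\<dots> = (LBINT w. Beta \<beta> \<gamma> *\<^sub>R (indicator {0<..} w *\<^sub>R ((w powr (\<beta> + \<gamma> - 1)) *\<^sub>R g (v + w))))"
  proof (rule Bochner_Integration.integral_cong[OF refl])
    fix w :: real
    show "(LBINT s. F w s) = Beta \<beta> \<gamma> *\<^sub>R (indicator {0<..} w *\<^sub>R ((w powr (\<beta> + \<gamma> - 1)) *\<^sub>R g (v + w)))"
    proof (cases "w > 0")
      case True
      then show ?thesis using k[OF True] by (simp add: F_def has_bochner_integral_iff h_def mult.commute)
    qed (simp add: F_def h0)
  qed
  also have "\<dots> = Beta \<beta> \<gamma> *\<^sub>R frac_integral (\<beta> + \<gamma>) g v"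
    unfolding frac_integral_def set_lebesgue_integral_def by (rule integral_scaleR_right)
  finally show ?thesis .
qed



section \<open>Order one, and differentiation of fractional integrals\<close>

lemma frac_integral_1_eq_integral:
  assumes "continuous_on {c..} g" "\<And>u. u \<ge> B \<Longrightarrow> g u = 0" "v \<ge> c"
  shows "frac_integral 1 g v = (LBINT u. indicator {v..B} u *\<^sub>R g u)"
proof -
  have "(LBINT u. indicator {v..B} u *\<^sub>R g u) = (LBINT s. indicator {v..B} (v + 1 * s) *\<^sub>R g (v + 1 * s))"
    by (subst lborel_integral_real_affine[where c = 1 and t = v]) auto
  also have "\<dots> = frac_integral 1 g v"
    unfolding frac_integral_def set_lebesgue_integral_def
  proof (rule integral_cong_AE)
    show "(\<lambda>s. indicator {v..B} (v + 1 * s) *\<^sub>R g (v + 1 * s)) \<in> borel_measurable lborel"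
    proof -
      have "continuous_on {v..B} g" using assms(1,3) by (auto intro: continuous_on_subset)
      then have "(\<lambda>u. indicator {v..B} u *\<^sub>R g u) \<in> borel_measurable borel"
        by (intro borel_measurable_continuous_on_indicator) auto
      then have "(\<lambda>s. (\<lambda>u. indicator {v..B} u *\<^sub>R g u) (v + 1 * s)) \<in> borel_measurable borel"
        by (rule measurable_compose[rotated]) measurable
      then show ?thesis by simp
    qed
    show "(\<lambda>s. indicator {0<..} s *\<^sub>R ((s powr (1 - 1)) *\<^sub>R g (v + s))) \<in> borel_measurable lborel"
      using measurable_shift_powr[OF assms(1,3), of 1] by simp
    \<comment> \<open>Equality can fail at s = 0, where only the left indicator is 1 and
      \<open>0 powr 0 = 0\<close>.\<close>
    show "AE s in lborel. indicator {v..B} (v + 1 * s) *\<^sub>R g (v + 1 * s)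
        = indicator {0<..} s *\<^sub>R ((s powr (1 - 1)) *\<^sub>R g (v + s))"
    proof (rule eventually_mono[OF AE_lborel_singleton[of 0]])
      fix s :: real assume "s \<noteq> 0"
      then show "indicator {v..B} (v + 1 * s) *\<^sub>R g (v + 1 * s)
        = indicator {0<..} s *\<^sub>R ((s powr (1 - 1)) *\<^sub>R g (v + s))"
        using assms(2)[of "v + s"] by (cases "v + s \<le> B") (auto simp: indicator_def)
    qed
  qed
  finally show ?thesis by simp
qed

lemma frac_integral_1_deriv:
  assumes g': "eventually_zero_cts {0<..} g'"
    and der: "\<And>u. u > 0 \<Longrightarrow> (g has_vector_derivative g' u) (at u)"
    and zero: "\<exists>A. \<forall>u\<ge>A. g u = 0" and v: "v > 0"
  shows "frac_integral 1 g' v = - g v"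
proof -
  obtain A B where AB: "\<And>u. u \<ge> A \<Longrightarrow> g u = 0" "\<And>u. u \<ge> B \<Longrightarrow> g' u = 0"
    using zero g' unfolding eventually_zero_cts_def by metis
  \<comment> \<open>C is not left of v and lies beyond the points where g and g' have vanished, so
    the boundary term at C is zero.\<close>
  define C where "C = max v (max A B)"
  have cont: "continuous_on {v..} g'"
    using g' v by (auto simp: eventually_zero_cts_def intro: continuous_on_subset)
  have "frac_integral 1 g' v = (LBINT u. indicator {v..C} u *\<^sub>R g' u)"
    using AB by (intro frac_integral_1_eq_integral[OF cont]) (auto simp: C_def)
  also have "\<dots> = g C - g v"
  proof (rule integral_FTC_atLeastAtMost)
    show "continuous_on {v..C} g'" using cont by (rule continuous_on_subset) auto
  qed (use v der in \<open>auto simp: C_def intro: has_vector_derivative_at_within\<close>)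
  also have "g C = 0" using AB by (simp add: C_def)
  finally show ?thesis by simp
qed

lemma frac_integral_1_has_vector_derivative:
  assumes g: "eventually_zero_cts {c..} g" and v: "v > c"
  shows "(frac_integral 1 g has_vector_derivative - g v) (at v)"
proof -
  obtain A where A: "\<And>u. u \<ge> A \<Longrightarrow> g u = 0"
    using g unfolding eventually_zero_cts_def by blast
  \<comment> \<open>The v + 1 makes v an interior point of the interval, so that a two-sided
    derivative results.\<close>
  define B where "B = max A (v + 1)"
  have cont: "continuous_on {c..} g" using g by (simp add: eventually_zero_cts_def)
  then have cont': "continuous_on {u..B} g" if "u \<ge> c" for u
    using that by (auto intro: continuous_on_subset)
  have eq: "frac_integral 1 g u = integral {u..B} g" if "u \<ge> c" for u
  proof -
    have "frac_integral 1 g u = (LBINT x:{u..B}. g x)"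
      unfolding set_lebesgue_integral_def
      using A that by (intro frac_integral_1_eq_integral[OF cont]) (auto simp: B_def)
    also have "\<dots> = integral {u..B} g"
      by (intro set_borel_integral_eq_integral borel_integrable_atLeastAtMost' cont' that)
    finally show ?thesis .
  qed
  have "((\<lambda>u. integral {u..B} g) has_vector_derivative - g v) (at v within {c..B})"
    by (rule integral_has_vector_derivative'[OF cont']) (use v in \<open>auto simp: B_def\<close>)
  then have "((\<lambda>u. integral {u..B} g) has_vector_derivative - g v) (at v within {c<..<B})"
    by (rule has_vector_derivative_within_subset) auto
  then have "((\<lambda>u. integral {u..B} g) has_vector_derivative - g v) (at v)"
    using v by (subst (asm) at_within_open) (auto simp: B_def)
  then show ?thesis
    by (rule has_vector_derivative_transform_within_open[where S = "{c<..}"])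
       (use v eq in auto)
qed

lemma Beta_1_right:
  fixes \<beta> :: real
  assumes "\<beta> > 0"
  shows "Beta \<beta> 1 = 1 / \<beta>"
proof -
  have "Gamma \<beta> \<noteq> 0" using Gamma_real_pos[OF assms] by linarith
  moreover have "Gamma (\<beta> + 1) = \<beta> * Gamma \<beta>"
    using assms by (intro Gamma_plus1) (auto elim!: nonpos_Ints_cases)
  ultimately show ?thesis using assms by (simp add: Beta_def)
qed

text \<open>Integration by parts, obtained from the semigroup law as I^\<beta> (I^1 g') = -
  I^\<beta> g; no boundary term at the singularity of the kernel has to be discussed. The factor
  \<beta> is 1 / \<open>Beta \<beta> 1\<close>.\<close>

lemma frac_integral_Suc_deriv:
  assumes g': "eventually_zero_cts {0<..} g'"
    and der: "\<And>u. u > 0 \<Longrightarrow> (g has_vector_derivative g' u) (at u)"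
    and zero: "\<exists>A. \<forall>u\<ge>A. g u = 0" and v: "v > 0" and "\<beta> > 0"
  shows "frac_integral (\<beta> + 1) g' v = - (\<beta> *\<^sub>R frac_integral \<beta> g v)"
proof -
  have "Beta \<beta> 1 *\<^sub>R frac_integral (\<beta> + 1) g' v = frac_integral \<beta> (frac_integral 1 g') v"
    by (intro frac_integral_frac_integral[symmetric, of v] eventually_zero_cts_subset[OF g'])
       (use v \<open>\<beta> > 0\<close> in auto)
  also have "\<dots> = frac_integral \<beta> (\<lambda>u. - g u) v"
    using v by (intro frac_integral_cong frac_integral_1_deriv[OF g' der zero]) auto
  also have "\<dots> = - frac_integral \<beta> g v"
    by (simp add: frac_integral_def set_lebesgue_integral_def)
  also have "Beta \<beta> 1 = 1 / \<beta>"
    using \<open>\<beta> > 0\<close> by (rule Beta_1_right)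
  finally have "\<beta> *\<^sub>R ((1 / \<beta>) *\<^sub>R frac_integral (\<beta> + 1) g' v) = \<beta> *\<^sub>R (- frac_integral \<beta> g v)"
    by (rule arg_cong)
  then show ?thesis using \<open>\<beta> > 0\<close> by simp
qed

text \<open>By the preceding lemma and the semigroup law, the integral of g is minus an order 1
  integral of the continuous function \<open>frac_integral \<beta> g'\<close>, whose derivative is
  known.\<close>

lemma frac_integral_has_vector_derivative:
  assumes g': "eventually_zero_cts {0<..} g'"
    and der: "\<And>u. u > 0 \<Longrightarrow> (g has_vector_derivative g' u) (at u)"
    and zero: "\<exists>A. \<forall>u\<ge>A. g u = 0" and v: "v > 0" and "\<beta> > 0"
  shows "(frac_integral \<beta> g has_vector_derivative frac_integral \<beta> g' v) (at v)"
proof -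
  have g'': "eventually_zero_cts {u..} g'" if "u > 0" for u
    by (rule eventually_zero_cts_subset[OF g']) (use that in auto)
  have "frac_integral \<beta> g u = - frac_integral 1 (frac_integral \<beta> g') u" if "u > 0" for u
  proof -
    have "Beta 1 \<beta> = 1 / \<beta>"
      using Beta_1_right[OF \<open>\<beta> > 0\<close>] Beta_commute[of 1 \<beta>] by metis
    moreover have "frac_integral 1 (frac_integral \<beta> g') u = Beta 1 \<beta> *\<^sub>R frac_integral (1 + \<beta>) g' u"
      using frac_integral_frac_integral[OF g''[OF that]] \<open>\<beta> > 0\<close> by simp
    moreover have "frac_integral (1 + \<beta>) g' u = - (\<beta> *\<^sub>R frac_integral \<beta> g u)"
      using frac_integral_Suc_deriv[OF g' der zero that \<open>\<beta> > 0\<close>] by (simp only: add.commute)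
    ultimately show ?thesis
      using \<open>\<beta> > 0\<close> by (simp only: scaleR_minus_right scaleR_scaleR) simp
  qed
  \<comment> \<open>Starting at v / 2 gives a closed half-line inside \<open>{0<..}\<close> that has
    v in its interior.\<close>
  moreover have "((\<lambda>u. - frac_integral 1 (frac_integral \<beta> g') u) has_vector_derivative frac_integral \<beta> g' v) (at v)"
    using has_vector_derivative_minus[OF frac_integral_1_has_vector_derivative[OF
      eventually_zero_cts_frac_integral[OF g''[of "v / 2"] \<open>\<beta> > 0\<close>], of v]] v by simp
  ultimately show ?thesis
    using v by (auto intro!: open_greaterThan
      elim!: has_vector_derivative_transform_within_open[where S = "{0<..}"])
qed

text \<open>Repeated integration by parts down to order 1. The factorial is Gamma (n + 1), by which
  the unnormalised kernel differs from the fractional integral.\<close>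

lemma frac_integral_iterated_deriv:
  assumes G: "\<And>n. eventually_zero_cts {0<..} (G n)"
    and der: "\<And>n u. u > 0 \<Longrightarrow> (G n has_vector_derivative G (Suc n) u) (at u)"
    and v: "v > 0"
  shows "frac_integral (real n + 1) (G (Suc n)) v = ((-1) ^ (n + 1) * fact n) *\<^sub>R G 0 v"
proof (induction n)
  case 0
  have "\<exists>A. \<forall>u\<ge>A. G 0 u = 0" using G[of 0] by (simp add: eventually_zero_cts_def)
  then show ?case using frac_integral_1_deriv[OF G der _ v, of 0] by simp
next
  case (Suc n)
  have "\<exists>A. \<forall>u\<ge>A. G (Suc n) u = 0" using G[of "Suc n"] by (simp add: eventually_zero_cts_def)
  then have "frac_integral (real n + 1 + 1) (G (Suc (Suc n))) v
      = - ((real n + 1) *\<^sub>R frac_integral (real n + 1) (G (Suc n)) v)"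
    by (intro frac_integral_Suc_deriv[OF G der _ v]) auto
  then show ?case unfolding Suc by (simp add: algebra_simps)
qed

lemma frac_integral_lincomb:
  assumes "eventually_zero_cts {c..} g" "eventually_zero_cts {c..} h" "v \<ge> c" "\<beta> > 0"
  shows "frac_integral \<beta> (\<lambda>u. s * g u + t * h u) v = s * frac_integral \<beta> g v + t * frac_integral \<beta> h v"
proof -
  let ?I = "\<lambda>g x. indicator {0<..} x *\<^sub>R ((x powr (\<beta> - 1)) *\<^sub>R g (v + x))"
  have "(\<lambda>x. ?I (\<lambda>u. s * g u + t * h u) x) = (\<lambda>x. s * ?I g x + t * ?I h x)"
    by (auto simp: fun_eq_iff indicator_def algebra_simps)
  then have "frac_integral \<beta> (\<lambda>u. s * g u + t * h u) v = (LBINT x. s * ?I g x + t * ?I h x)"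
    by (simp only: frac_integral_def set_lebesgue_integral_def)
  also have "\<dots> = (LBINT x. s * ?I g x) + (LBINT x. t * ?I h x)"
    by (intro Bochner_Integration.integral_add integrable_mult_right frac_integrand_integrable[OF _ assms(4,3)] assms(1,2))
  also have "\<dots> = s * frac_integral \<beta> g v + t * frac_integral \<beta> h v"
    by (simp only: frac_integral_def set_lebesgue_integral_def integral_mult_right_zero)
  finally show ?thesis .
qed

text \<open>Derivative at \<open>c = 1\<close> of the homogeneity \<open>I\<^sup>\<beta> (g(c u)) (v) = c\<^sup>-\<^sup>\<beta> I\<^sup>\<beta> g (c v)\<close>.\<close>

lemma frac_integral_euler:
  assumes g': "eventually_zero_cts {0<..} g'"
    and der: "\<And>u. u > 0 \<Longrightarrow> (g has_vector_derivative g' u) (at u)"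
    and zero: "\<exists>A. \<forall>u\<ge>A. g u = 0" and v: "v > 0" and "\<beta> > 0"
  shows "v *\<^sub>R frac_integral \<beta> g' v = \<beta> *\<^sub>R frac_integral \<beta> g v + frac_integral \<beta> (\<lambda>u. u *\<^sub>R g' u) v"
proof -
  have g'': "eventually_zero_cts {v..} g'"
    by (rule eventually_zero_cts_subset[OF g']) (use v in auto)
  let ?I = "\<lambda>\<beta> g x. indicator {0<..} x *\<^sub>R ((x powr (\<beta> - 1)) *\<^sub>R g (v + x))"
  \<comment> \<open>At v + x the weight u splits into v and x; the factor x raises the order of the
    kernel by one.\<close>
  have "?I \<beta> (\<lambda>u. u *\<^sub>R g' u) x = v *\<^sub>R ?I \<beta> g' x + ?I (\<beta> + 1) g' x" for x
  proof (cases "x > 0")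
    case True
    then have "x powr (\<beta> + 1 - 1) = x powr (\<beta> - 1) * x"
      using powr_add[of x "\<beta> - 1" 1] by simp
    with True show ?thesis by (simp add: scaleR_add_left algebra_simps)
  qed auto
  then have "frac_integral \<beta> (\<lambda>u. u *\<^sub>R g' u) v = (LBINT x. v *\<^sub>R ?I \<beta> g' x + ?I (\<beta> + 1) g' x)"
    by (simp only: frac_integral_def set_lebesgue_integral_def)
  also have "\<dots> = (LBINT x. v *\<^sub>R ?I \<beta> g' x) + (LBINT x. ?I (\<beta> + 1) g' x)"
    using \<open>\<beta> > 0\<close> by (intro Bochner_Integration.integral_add integrable_scaleR_right frac_integrand_integrable[OF g'']) auto
  also have "\<dots> = v *\<^sub>R frac_integral \<beta> g' v + frac_integral (\<beta> + 1) g' v"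
    by (simp only: frac_integral_def set_lebesgue_integral_def integral_scaleR_right)
  also have "frac_integral (\<beta> + 1) g' v = - (\<beta> *\<^sub>R frac_integral \<beta> g v)"
    by (rule frac_integral_Suc_deriv[OF assms])
  finally show ?thesis by simp
qed

section \<open>Smooth functions on the line and on the punctured line\<close>

lemma funpow_vderiv_coinduct:
  assumes "open S" "P f"
    and step: "\<And>h. P h \<Longrightarrow> \<exists>h'. P h' \<and> (\<forall>x\<in>S. (h has_vector_derivative h' x) (at x))"
  shows "\<exists>h. P h \<and> (\<forall>x\<in>S. (vderiv ^^ n) f x = h x)"
proof (induction n)
  case 0
  then show ?case using assms(2) by auto
next
  case (Suc n)
  then obtain h where h: "P h" "\<forall>x\<in>S. (vderiv ^^ n) f x = h x" by blast
  obtain h' where h': "P h'" "\<forall>x\<in>S. (h has_vector_derivative h' x) (at x)"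
    using step[OF h(1)] by blast
  have "(vderiv ^^ Suc n) f x = h' x" if "x \<in> S" for x
  proof -
    have "((vderiv ^^ n) f has_vector_derivative h' x) (at x)"
      by (rule has_vector_derivative_transform_within_open[where S = S and f = h])
         (use h h' that assms(1) in auto)
    then show ?thesis by (simp add: vderiv_def vector_derivative_at)
  qed
  with h'(1) show ?case by blast
qed

text \<open>Exhibiting a class that is closed under differentiation on S replaces formulas for the
  n-th derivative.\<close>

lemma smooth_on_coinduct:
  assumes "open S" "P f"
    and step: "\<And>h. P h \<Longrightarrow> \<exists>h'. P h' \<and> (\<forall>x\<in>S. (h has_vector_derivative h' x) (at x))"
  shows "smooth_on S f"
  unfolding smooth_on_def
proof (intro allI ballI)
  fix n x assume x: "x \<in> S"
  obtain h where h: "P h" "\<forall>x\<in>S. (vderiv ^^ n) f x = h x"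
    using funpow_vderiv_coinduct[OF assms, where n = n] by blast
  obtain h' where h': "\<forall>x\<in>S. (h has_vector_derivative h' x) (at x)"
    using step[OF h(1)] by blast
  have "((vderiv ^^ n) f has_vector_derivative h' x) (at x)"
    by (rule has_vector_derivative_transform_within_open[where S = S and f = h])
       (use h h' x assms(1) in auto)
  then show "(vderiv ^^ n) f differentiable at x"
    by (rule differentiableI_vector)
qed

lemma smooth_on_has_vector_derivative:
  assumes "smooth_on S f" "x \<in> S"
  shows "((vderiv ^^ n) f has_vector_derivative (vderiv ^^ Suc n) f x) (at x)"
  using assms vector_derivative_works unfolding smooth_on_def by (auto simp: vderiv_def)

lemma smooth_on_has_vector_derivative_0:
  assumes "smooth_on S f" "x \<in> S"
  shows "(f has_vector_derivative vderiv f x) (at x)"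
  using smooth_on_has_vector_derivative[OF assms, of 0] by simp

lemma funpow_vderiv_cong:
  assumes "open S" "\<And>x. x \<in> S \<Longrightarrow> f x = g x" "x \<in> S"
  shows "(vderiv ^^ n) f x = (vderiv ^^ n) g x"
  using assms(3)
proof (induction n arbitrary: x)
  case (Suc n)
  have "eventually (\<lambda>y. y \<in> S) (nhds x)"
    using assms(1) Suc.prems by (rule eventually_nhds_in_open)
  then have "eventually (\<lambda>y. (vderiv ^^ n) f y = (vderiv ^^ n) g y) (nhds x)"
    by eventually_elim (rule Suc.IH)
  then have "vector_derivative ((vderiv ^^ n) f) (at x) = vector_derivative ((vderiv ^^ n) g) (at x)"
    by (intro vector_derivative_cong_eq) auto
  then show ?case
    by (simp add: vderiv_def[of "(vderiv ^^ n) _"])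
qed (use assms in auto)

lemma smooth_on_vderiv: "smooth_on S f \<Longrightarrow> smooth_on S (vderiv f)"
  using funpow_Suc_right[of _ vderiv] unfolding smooth_on_def by (metis comp_apply)

lemma smooth_on_subset: "smooth_on S f \<Longrightarrow> T \<subseteq> S \<Longrightarrow> smooth_on T f"
  unfolding smooth_on_def by blast

lemma smooth_on_imp_continuous_on:
  assumes "smooth_on S f"
  shows "continuous_on S f"
proof (intro continuous_at_imp_continuous_on ballI)
  fix x assume "x \<in> S"
  then show "isCont f x"
    using has_vector_derivative_continuous[OF smooth_on_has_vector_derivative_0[OF assms]] by simp
qed

text \<open>The algebra generated by all derivatives of f and g: the Leibniz rule makes it closed
  under differentiation, so it is a class for \<open>smooth_on_coinduct\<close>.\<close>

inductive_set diff_algebra :: "(real \<Rightarrow> complex) \<Rightarrow> (real \<Rightarrow> complex) \<Rightarrow> (real \<Rightarrow> complex) set"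
  for f g where
  "(vderiv ^^ n) f \<in> diff_algebra f g"
| "(vderiv ^^ n) g \<in> diff_algebra f g"
| "h \<in> diff_algebra f g \<Longrightarrow> k \<in> diff_algebra f g \<Longrightarrow> (\<lambda>x. h x + k x) \<in> diff_algebra f g"
| "h \<in> diff_algebra f g \<Longrightarrow> k \<in> diff_algebra f g \<Longrightarrow> (\<lambda>x. h x * k x) \<in> diff_algebra f g"

lemma smooth_on_diff_algebra:
  assumes "open S" "smooth_on S f" "smooth_on S g" "h \<in> diff_algebra f g"
  shows "smooth_on S h"
proof (rule smooth_on_coinduct[OF assms(1), of "\<lambda>h. h \<in> diff_algebra f g"])
  fix h assume "h \<in> diff_algebra f g"
  then show "\<exists>h'. h' \<in> diff_algebra f g \<and> (\<forall>x\<in>S. (h has_vector_derivative h' x) (at x))"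
  proof induction
    case (1 n)
    show ?case using smooth_on_has_vector_derivative[OF assms(2)] diff_algebra.intros(1) by blast
  next
    case (2 n)
    show ?case using smooth_on_has_vector_derivative[OF assms(3)] diff_algebra.intros(2) by blast
  next
    case (3 h k)
    then obtain h' k' where d: "h' \<in> diff_algebra f g" "\<forall>x\<in>S. (h has_vector_derivative h' x) (at x)"
      "k' \<in> diff_algebra f g" "\<forall>x\<in>S. (k has_vector_derivative k' x) (at x)" by blast
    then have "(\<lambda>x. h' x + k' x) \<in> diff_algebra f g"
      by (intro diff_algebra.intros(3))
    moreover have "((\<lambda>x. h x + k x) has_vector_derivative h' x + k' x) (at x)" if "x \<in> S" for x
      using d that by (intro has_vector_derivative_add) auto
    ultimately show ?case by blast
  next
    case (4 h k)
    then obtain h' k' where d: "h' \<in> diff_algebra f g" "\<forall>x\<in>S. (h has_vector_derivative h' x) (at x)"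
      "k' \<in> diff_algebra f g" "\<forall>x\<in>S. (k has_vector_derivative k' x) (at x)" by blast
    then have "(\<lambda>x. h x * k' x + h' x * k x) \<in> diff_algebra f g"
      using 4 by (intro diff_algebra.intros(3,4))
    moreover have "((\<lambda>x. h x * k x) has_vector_derivative h x * k' x + h' x * k x) (at x)" if "x \<in> S" for x
      using d that by (intro has_vector_derivative_mult) auto
    ultimately show ?case by blast
  qed
qed fact

lemma smooth_on_mult:
  assumes "open S" "smooth_on S f" "smooth_on S g"
  shows "smooth_on S (\<lambda>x. f x * g x)"
proof -
  have "f \<in> diff_algebra f g" "g \<in> diff_algebra f g"
    using diff_algebra.intros(1)[of 0 f g] diff_algebra.intros(2)[of 0 g f] by auto
  then show ?thesis by (intro smooth_on_diff_algebra[OF assms] diff_algebra.intros(4))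
qed

lemma smooth_on_add:
  assumes "open S" "smooth_on S f" "smooth_on S g"
  shows "smooth_on S (\<lambda>x. f x + g x)"
proof -
  have "f \<in> diff_algebra f g" "g \<in> diff_algebra f g"
    using diff_algebra.intros(1)[of 0 f g] diff_algebra.intros(2)[of 0 g f] by auto
  then show ?thesis by (intro smooth_on_diff_algebra[OF assms] diff_algebra.intros(3))
qed

lemma smooth_on_const: "open S \<Longrightarrow> smooth_on S (\<lambda>x. c)"
  by (rule smooth_on_coinduct[where P = "\<lambda>h. \<exists>c. h = (\<lambda>x. c)"])
     (auto intro!: exI[of _ "\<lambda>x. 0"])

lemma smooth_on_of_real: "open S \<Longrightarrow> smooth_on S of_real"
proof (rule smooth_on_coinduct[where P = "\<lambda>h. h = of_real \<or> (\<exists>c. h = (\<lambda>x. c))"])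
  fix h :: "real \<Rightarrow> complex" assume "h = of_real \<or> (\<exists>c. h = (\<lambda>x. c))"
  then show "\<exists>h'. (h' = of_real \<or> (\<exists>c. h' = (\<lambda>x. c))) \<and> (\<forall>x\<in>S. (h has_vector_derivative h' x) (at x))"
  proof
    assume h: "h = of_real"
    have "(h has_vector_derivative 1) (at x)" for x
      unfolding h using has_vector_derivative_of_real[OF DERIV_ident] by simp
    then show ?thesis by (intro exI[of _ "\<lambda>x. 1"]) auto
  next
    assume "\<exists>c. h = (\<lambda>x. c)"
    then show ?thesis by (intro exI[of _ "\<lambda>x. 0"]) auto
  qed
qed auto

text \<open>The multiples of negative powers form a class closed under differentiation; the
  coefficient absorbs the exponents that come down.\<close>

lemma smooth_on_inverse: "smooth_on (- {0}) (\<lambda>x. of_real (inverse x))"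
proof (rule smooth_on_coinduct[where P = "\<lambda>h. \<exists>c n. h = (\<lambda>x. of_real (c * inverse x ^ n))"])
  show "\<exists>c n. (\<lambda>x. complex_of_real (inverse x)) = (\<lambda>x. of_real (c * inverse x ^ n))"
    by (intro exI[of _ 1]) simp
  fix h :: "real \<Rightarrow> complex" assume "\<exists>c n. h = (\<lambda>x. of_real (c * inverse x ^ n))"
  then obtain c n where h: "h = (\<lambda>x. of_real (c * inverse x ^ n))" by blast
  have "(h has_vector_derivative of_real ((- c * real n) * inverse x ^ Suc n)) (at x)" if "x \<noteq> 0" for x
    unfolding h
  proof (rule has_vector_derivative_of_real)
    show "((\<lambda>x. c * inverse x ^ n) has_field_derivative (- c * real n) * inverse x ^ Suc n) (at x)"
    proof (rule DERIV_cong)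
      show "((\<lambda>x. c * inverse x ^ n) has_field_derivative
          c * (of_nat n * (- (inverse x ^ Suc (Suc 0)) * inverse x ^ (n - Suc 0)))) (at x)"
        by (intro DERIV_cmult DERIV_power DERIV_inverse that)
    \<comment> \<open>For n = 0 the truncated exponent n - 1 is harmless, since its coefficient n
      vanishes.\<close>
    qed (cases n; simp)
  qed
  then show "\<exists>h'. (\<exists>c n. h' = (\<lambda>x. complex_of_real (c * inverse x ^ n))) \<and>
      (\<forall>x\<in>- {0}. (h has_vector_derivative h' x) (at x))"
    by (intro exI[of _ "\<lambda>x. of_real ((- c * real n) * inverse x ^ Suc n)"] conjI
        exI[of _ "- c * real n"] exI[of _ "Suc n"] refl) simp
qed auto

lemma smooth_on_ddx2:
  assumes "smooth_on (- {0}) f"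
  shows "smooth_on (- {0}) (ddx2 f)"
proof -
  have eq: "ddx2 f = (\<lambda>x. ((1 / 2) * of_real (inverse x)) * vderiv f x)"
    by (auto simp: ddx2_def fun_eq_iff scaleR_conv_of_real field_simps)
  show ?thesis
    unfolding eq by (intro smooth_on_mult smooth_on_const smooth_on_inverse smooth_on_vderiv assms) auto
qed

lemma smooth_on_funpow_ddx2:
  "smooth_on (- {0}) f \<Longrightarrow> smooth_on (- {0}) ((ddx2 ^^ n) f)"
  by (induction n) (auto intro: smooth_on_ddx2)

section \<open>Supports and test functions\<close>

lemma fun_support_subset_iff: "fun_support f \<subseteq> {-a..a} \<longleftrightarrow> (\<forall>x. a < \<bar>x\<bar> \<longrightarrow> f x = 0)"
proof
  assume "fun_support f \<subseteq> {-a..a}"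
  then have "{x. f x \<noteq> 0} \<subseteq> {-a..a}"
    unfolding fun_support_def by (rule order_trans[OF closure_subset])
  moreover have "x \<notin> {-a..a}" if "a < \<bar>x\<bar>" for x using that by auto
  ultimately show "\<forall>x. a < \<bar>x\<bar> \<longrightarrow> f x = 0" by blast
next
  assume *: "\<forall>x. a < \<bar>x\<bar> \<longrightarrow> f x = 0"
  have "x \<in> {-a..a}" if "f x \<noteq> 0" for x
  proof -
    have "\<not> a < \<bar>x\<bar>" using * that by blast
    then show ?thesis by auto
  qed
  then have "{x. f x \<noteq> 0} \<subseteq> {-a..a}" by blast
  then show "fun_support f \<subseteq> {-a..a}"
    unfolding fun_support_def by (intro closure_minimal) auto
qed

lemma vderiv_eq_0:
  assumes "\<forall>x. a < \<bar>x\<bar> \<longrightarrow> f x = 0" "a < \<bar>x\<bar>"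
  shows "(vderiv ^^ n) f x = 0"
proof -
  have "open {x::real. a < \<bar>x\<bar>}" by (intro open_Collect_less continuous_intros)
  from funpow_vderiv_cong[OF this, of f "\<lambda>x. 0" x n] show ?thesis using assms by simp
qed

lemma funpow_ddx2_eq_0:
  assumes "\<forall>x. a < \<bar>x\<bar> \<longrightarrow> f x = 0"
  shows "\<forall>x. a < \<bar>x\<bar> \<longrightarrow> (ddx2 ^^ n) f x = 0"
proof (induction n)
  case (Suc n)
  then show ?case using vderiv_eq_0[OF Suc, where n = 1] by (auto simp: ddx2_def)
qed (use assms in auto)

lemma test_functions_on_iff:
  "f \<in> test_functions_on a \<longleftrightarrow> smooth_on UNIV f \<and> (\<forall>x. a < \<bar>x\<bar> \<longrightarrow> f x = 0)"
  by (simp add: test_functions_on_def fun_support_subset_iff)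

lemma test_functions_on_lincomb:
  assumes "f \<in> test_functions_on a" "g \<in> test_functions_on a"
  shows "(\<lambda>x. s * f x + t * g x) \<in> test_functions_on a"
  using assms unfolding test_functions_on_iff
  by (auto intro!: smooth_on_add smooth_on_mult smooth_on_const)

lemma test_functions_on_euler:
  assumes "f \<in> test_functions_on a"
  shows "(\<lambda>x. of_real x * vderiv f x) \<in> test_functions_on a"
  using assms vderiv_eq_0[of a f _ 1] unfolding test_functions_on_iff
  by (auto intro!: smooth_on_mult smooth_on_of_real smooth_on_vderiv)

section \<open>Folding the half-lines by \<open>u = x\<^sup>2\<close>\<close>

definition fold_half :: "real \<Rightarrow> (real \<Rightarrow> complex) \<Rightarrow> real \<Rightarrow> complex" where
  "fold_half \<sigma> F u = F (\<sigma> * sqrt u)"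

lemma fold_half_sgn_power2: "fold_half (sgn y) F (y\<^sup>2) = F y"
  by (simp add: fold_half_def sgn_mult_abs)

lemma fold_half_has_vector_derivative:
  assumes F: "smooth_on (- {0}) F" and \<sigma>: "\<sigma> \<in> {1, -1}" and u: "u > 0"
  shows "(fold_half \<sigma> F has_vector_derivative fold_half \<sigma> (ddx2 F) u) (at u)"
proof -
  have 1: "((\<lambda>u. \<sigma> * sqrt u) has_vector_derivative (\<sigma> * (inverse (sqrt u) / 2))) (at u)"
    unfolding has_real_derivative_iff_has_vector_derivative[symmetric]
    using u by (auto intro!: derivative_eq_intros)
  have 2: "(F has_vector_derivative vderiv F (\<sigma> * sqrt u)) (at (\<sigma> * sqrt u))"
    by (rule smooth_on_has_vector_derivative_0[OF F]) (use \<sigma> u in auto)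
  have "F \<circ> (\<lambda>u. \<sigma> * sqrt u) = fold_half \<sigma> F" by (auto simp: fold_half_def)
  \<comment> \<open>As \<sigma> = 1 / \<sigma>, the inner derivative is 1 / (2 x) at x = \<sigma>
    sqrt u, the coefficient in \<open>ddx2\<close>.\<close>
  moreover have "(\<sigma> * (inverse (sqrt u) / 2)) *\<^sub>R vderiv F (\<sigma> * sqrt u) = fold_half \<sigma> (ddx2 F) u"
    using \<sigma> u by (auto simp: fold_half_def ddx2_def field_simps)
  ultimately show ?thesis using vector_diff_chain_at[OF 1 2] by simp
qed

lemma eventually_zero_fold_half:
  assumes "\<forall>x. a < \<bar>x\<bar> \<longrightarrow> F x = 0" "\<sigma> \<in> {1, -1}"
  shows "\<exists>A. \<forall>u\<ge>A. fold_half \<sigma> F u = 0"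
proof (intro exI allI impI)
  fix u assume "u \<ge> a\<^sup>2 + 1"
  then have "sqrt u > \<bar>a\<bar>" by (intro real_less_rsqrt) auto
  then show "fold_half \<sigma> F u = 0" using assms by (auto simp: fold_half_def)
qed

lemma eventually_zero_cts_fold_half:
  assumes "continuous_on (- {0}) F" "\<forall>x. a < \<bar>x\<bar> \<longrightarrow> F x = 0" "\<sigma> \<in> {1, -1}"
  shows "eventually_zero_cts {0<..} (fold_half \<sigma> F)"
proof -
  have "continuous_on {0<..} (fold_half \<sigma> F)"
    unfolding fold_half_def[abs_def]
    by (rule continuous_on_compose2[OF assms(1)]) (use assms(3) in \<open>auto intro!: continuous_intros\<close>)
  with eventually_zero_fold_half[OF assms(2,3)] show ?thesis
    by (simp add: eventually_zero_cts_def)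
qed

text \<open>The version up to u = 0, for functions continuous on the whole line. It does not extend
  to derivatives: d/du of the folded function can behave like 1 / sqrt u.\<close>

lemma eventually_zero_cts_fold_half_closed:
  assumes "continuous_on UNIV F" "\<forall>x. a < \<bar>x\<bar> \<longrightarrow> F x = 0" "\<sigma> \<in> {1, -1}"
  shows "eventually_zero_cts {0..} (fold_half \<sigma> F)"
proof -
  have "continuous_on {0..} (fold_half \<sigma> F)"
    unfolding fold_half_def[abs_def]
    by (rule continuous_on_compose2[OF assms(1)]) (use assms(3) in \<open>auto intro!: continuous_intros\<close>)
  with eventually_zero_fold_half[OF assms(2,3)] show ?thesis
    by (simp add: eventually_zero_cts_def)
qed

text \<open>A common form for two integrals: \<beta> = \<alpha> + 1/2 gives the one in
  \<open>Weyl\<close>, and \<beta> = 1/2 - r the one in \<open>inverse_Weyl\<close>.\<close>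

definition radial_integral :: "real \<Rightarrow> (real \<Rightarrow> complex) \<Rightarrow> real \<Rightarrow> complex" where
  "radial_integral \<beta> F y = (LBINT x:{\<bar>y\<bar>..}. ((x\<^sup>2 - y\<^sup>2) powr (\<beta> - 1) * x) *\<^sub>R F (sgn y * x))"

lemma radial_integral_eq_frac_integral:
  assumes F: "continuous_on (- {0}) F" "\<forall>x. a < \<bar>x\<bar> \<longrightarrow> F x = 0" and "\<beta> > 0" and y: "y \<noteq> 0"
  shows "radial_integral \<beta> F y = (1 / 2) *\<^sub>R frac_integral \<beta> (fold_half (sgn y) F) (y\<^sup>2)"
proof -
  define f where "f x = ((x\<^sup>2 - y\<^sup>2) powr (\<beta> - 1) * x) *\<^sub>R F (sgn y * x)" for x
  define g where "g s = sqrt (y\<^sup>2 + s)" for s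
  define g' where "g' s = inverse (sqrt (y\<^sup>2 + s)) / 2" for s
  let ?k = "\<lambda>s. (s powr (\<beta> - 1)) *\<^sub>R fold_half (sgn y) F (y\<^sup>2 + s)"
  have sgn: "sgn y \<in> {1, -1}" using y by (auto simp: sgn_if)
  have y2: "y\<^sup>2 > 0" using y by simp
  have g_gt: "g s > \<bar>y\<bar>" if "s > 0" for s
    unfolding g_def by (rule real_less_rsqrt) (use that in simp)
  \<comment> \<open>With x = sqrt (y^2 + s) one has x dx = ds / 2, the source of the factor
    1/2.\<close>
  have key: "g' s *\<^sub>R f (g s) = (1 / 2) *\<^sub>R ?k s" if "s > 0" for s
  proof -
    have "y\<^sup>2 + s > 0" using y2 that by (rule add_pos_pos)
    then show ?thesis using that by (simp add: f_def g_def g'_def fold_half_def)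
  qed
  have ez: "eventually_zero_cts {y\<^sup>2..} (fold_half (sgn y) F)"
    using y2 by (intro eventually_zero_cts_subset[OF eventually_zero_cts_fold_half[OF F sgn]])
      (meson atLeast_iff greaterThan_iff order_less_le_trans subsetI)
  have int: "set_integrable lborel {0<..} ?k"
    unfolding set_integrable_def by (rule frac_integrand_integrable[OF ez \<open>\<beta> > 0\<close>]) simp
  have int_g: "set_integrable lborel (einterval 0 \<infinity>) (\<lambda>s. g' s *\<^sub>R f (g s))"
  proof -
    have "set_integrable lborel {0<..} (\<lambda>s. (1 / 2) *\<^sub>R ?k s)"
      using int by (rule set_integrable_scaleR_right)
    also have "?this \<longleftrightarrow> set_integrable lborel {0<..} (\<lambda>s. g' s *\<^sub>R f (g s))"
      by (intro set_integrable_cong) (auto simp: key)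
    finally show ?thesis by (simp add: zero_ereal_def)
  qed
  have F_cont: "isCont F x" if "x \<noteq> 0" for x
    using F(1) that continuous_on_eq_continuous_at[of "- {0}" F] by auto
  have f_cont: "isCont f x" if "x > \<bar>y\<bar>" for x
  proof -
    have "x\<^sup>2 - y\<^sup>2 \<noteq> 0" using that by (auto simp: power2_eq_iff)
    moreover have "isCont (\<lambda>x. F (sgn y * x)) x"
      by (rule isCont_o2[where g = F]) (use that y in \<open>auto intro!: F_cont simp: sgn_eq_0_iff\<close>)
    ultimately show ?thesis
      unfolding f_def[abs_def] by (intro continuous_intros) auto
  qed
  have deriv: "DERIV g s :> g' s" if "s > 0" for s
    unfolding g_def[abs_def] g'_def using add_pos_pos[OF y2 that]
    by (auto intro!: derivative_eq_intros)
  have g'_cont: "isCont g' s" if "s > 0" for s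
    unfolding g'_def[abs_def] using add_pos_pos[OF y2 that] by (intro continuous_intros) auto
  have g'_nonneg: "g' s \<ge> 0" if "s \<ge> 0" for s
    using that by (simp add: g'_def)
  have lim0: "((ereal \<circ> g \<circ> real_of_ereal) \<longlongrightarrow> ereal \<bar>y\<bar>) (at_right 0)"
  proof -
    have "(g \<longlongrightarrow> sqrt (y\<^sup>2 + 0)) (at_right 0)"
      unfolding g_def[abs_def] by (intro tendsto_intros)
    then show ?thesis by (simp add: zero_ereal_def ereal_tendsto_simps)
  qed
  have lim1: "((ereal \<circ> g \<circ> real_of_ereal) \<longlongrightarrow> \<infinity>) (at_left \<infinity>)"
  proof -
    have "filterlim g at_top at_top"
      unfolding g_def[abs_def]
      by (intro filterlim_compose[OF sqrt_at_top] filterlim_tendsto_add_at_top[OF tendsto_const] filterlim_ident)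
    then show ?thesis by (simp add: ereal_tendsto_simps)
  qed
  \<comment> \<open>The substitution rule for complex integrands presupposes integrability on both
    sides. On the x side it comes from the nonnegative version applied to the norm.\<close>
  have int_norm: "set_integrable lborel (einterval \<bar>y\<bar> \<infinity>) (\<lambda>x. norm (f x))"
  proof (rule interval_integral_substitution_nonneg(1)[OF _ _ _ _ _ _ lim0 lim1])
    have "set_integrable lborel (einterval 0 \<infinity>) (\<lambda>s. norm (g' s *\<^sub>R f (g s)))"
      using int_g by (rule set_integrable_norm)
    also have "?this \<longleftrightarrow> set_integrable lborel (einterval 0 \<infinity>) (\<lambda>s. norm (f (g s)) * g' s)"
      by (intro set_integrable_cong) (auto simp: zero_ereal_def g'_nonneg mult.commute)
    finally show "set_integrable lborel (einterval 0 \<infinity>) (\<lambda>s. norm (f (g s)) * g' s)" .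
  qed (auto simp: zero_ereal_def intro!: deriv g'_cont g'_nonneg continuous_norm f_cont g_gt)
  have int_f: "set_integrable lborel (einterval \<bar>y\<bar> \<infinity>) f"
  proof -
    have "continuous_on {\<bar>y\<bar><..} f"
      using f_cont by (intro continuous_at_imp_continuous_on) auto
    then have "(\<lambda>x. indicator {\<bar>y\<bar><..} x *\<^sub>R f x) \<in> borel_measurable lborel"
      using borel_measurable_continuous_on_indicator[of "{\<bar>y\<bar><..}" f] by simp
    then have "integrable lborel (\<lambda>x. norm (indicator {\<bar>y\<bar><..} x *\<^sub>R f x))
        \<longleftrightarrow> integrable lborel (\<lambda>x. indicator {\<bar>y\<bar><..} x *\<^sub>R f x)"
      by (rule integrable_norm_iff)
    with int_norm show ?thesis by (simp add: set_integrable_def)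
  qed
  \<comment> \<open>The endpoint x = |y| may be dropped pointwise, because \<open>0 powr\<close> any
    exponent is 0.\<close>
  have "radial_integral \<beta> F y = (LBINT x:{\<bar>y\<bar><..}. f x)"
    unfolding radial_integral_def set_lebesgue_integral_def
    by (intro Bochner_Integration.integral_cong) (auto simp: f_def indicator_def)
  also have "\<dots> = (LBINT x=ereal \<bar>y\<bar>..\<infinity>. f x)"
    by (simp add: interval_lebesgue_integral_def)
  also have "\<dots> = (LBINT s=0..\<infinity>. g' s *\<^sub>R f (g s))"
    by (rule interval_integral_substitution_integrable[OF _ _ _ _ _ lim0 lim1 int_g int_f])
       (auto simp: zero_ereal_def intro!: deriv g'_cont g'_nonneg f_cont g_gt)
  also have "\<dots> = (LBINT s:{0<..}. g' s *\<^sub>R f (g s))"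
    by (simp add: interval_lebesgue_integral_def zero_ereal_def)
  also have "\<dots> = (LBINT s:{0<..}. (1 / 2) *\<^sub>R ?k s)"
    by (intro set_lebesgue_integral_cong) (auto simp: key)
  also have "\<dots> = (1 / 2) *\<^sub>R frac_integral \<beta> (fold_half (sgn y) F) (y\<^sup>2)"
    unfolding frac_integral_def by (rule set_integral_scaleR_right)
  finally show ?thesis .
qed

section \<open>The Weyl transform of test functions\<close>

text \<open>Half of the constant in \<open>Weyl\<close>; the missing 2 cancels the 1/2 of the
  substitution u = x^2.\<close>

definition Weyl_factor :: "real \<Rightarrow> real" where
  "Weyl_factor \<alpha> = Gamma (\<alpha> + 1) / (sqrt pi * Gamma (\<alpha> + 1/2))"

lemma Weyl_factor_pos: "\<alpha> > -1/2 \<Longrightarrow> Weyl_factor \<alpha> > 0"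
  unfolding Weyl_factor_def by (intro divide_pos_pos mult_pos_pos Gamma_real_pos) auto

lemma Weyl_0 [simp]: "Weyl \<alpha> f 0 = 0"
  by (simp add: Weyl_def)

lemma Weyl_eq_radial_integral:
  assumes "y \<noteq> 0"
  shows "Weyl \<alpha> f y = (2 * Weyl_factor \<alpha>) *\<^sub>R radial_integral (\<alpha> + 1/2) f y"
proof -
  have exponent: "\<alpha> + 1/2 - 1 = \<alpha> - 1/2" by simp
  show ?thesis
    using assms unfolding Weyl_def radial_integral_def exponent Weyl_factor_def by simp
qed

lemma Weyl_eq_frac_integral:
  assumes "continuous_on (- {0}) f" "\<forall>x. a < \<bar>x\<bar> \<longrightarrow> f x = 0" "\<alpha> > -1/2" "y \<noteq> 0"
  shows "Weyl \<alpha> f y = Weyl_factor \<alpha> *\<^sub>R frac_integral (\<alpha> + 1/2) (fold_half (sgn y) f) (y\<^sup>2)"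
proof -
  have "Weyl \<alpha> f y = (2 * Weyl_factor \<alpha>) *\<^sub>R radial_integral (\<alpha> + 1/2) f y"
    by (rule Weyl_eq_radial_integral[OF assms(4)])
  also have "radial_integral (\<alpha> + 1/2) f y = (1 / 2) *\<^sub>R frac_integral (\<alpha> + 1/2) (fold_half (sgn y) f) (y\<^sup>2)"
    by (rule radial_integral_eq_frac_integral) (use assms in auto)
  finally show ?thesis by simp
qed

lemma fold_half_Weyl:
  assumes "continuous_on (- {0}) f" "\<forall>x. a < \<bar>x\<bar> \<longrightarrow> f x = 0" "\<alpha> > -1/2" "u > 0" "\<sigma> \<in> {1, -1}"
  shows "fold_half \<sigma> (Weyl \<alpha> f) u = Weyl_factor \<alpha> *\<^sub>R frac_integral (\<alpha> + 1/2) (fold_half \<sigma> f) u"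
proof -
  have "sgn (\<sigma> * sqrt u) = \<sigma>" "(\<sigma> * sqrt u)\<^sup>2 = u"
    using assms(4,5) by (auto simp: sgn_if)
  then show ?thesis
    using Weyl_eq_frac_integral[OF assms(1-3), of "\<sigma> * sqrt u"] assms(4,5)
    unfolding fold_half_def[of \<sigma> "Weyl \<alpha> f"] by auto
qed

lemma radial_integral_eq_0:
  assumes "\<forall>x. a < \<bar>x\<bar> \<longrightarrow> F x = 0" "a < \<bar>y\<bar>" "y \<noteq> 0"
  shows "radial_integral \<beta> F y = 0"
proof -
  have "F (sgn y * x) = 0" if "x \<ge> \<bar>y\<bar>" for x
    using assms that by (auto simp: abs_mult sgn_if)
  then have "radial_integral \<beta> F y = (LBINT x:{\<bar>y\<bar>..}. 0)"
    unfolding radial_integral_def by (intro set_lebesgue_integral_cong) auto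
  then show ?thesis by (simp add: set_lebesgue_integral_def)
qed

lemma Weyl_eq_0:
  assumes "\<forall>x. a < \<bar>x\<bar> \<longrightarrow> f x = 0" "a < \<bar>y\<bar>"
  shows "Weyl \<alpha> f y = 0"
  using radial_integral_eq_0[OF assms] by (cases "y = 0") (auto simp: Weyl_eq_radial_integral)

lemma test_functions_onD:
  assumes "f \<in> test_functions_on a"
  shows "smooth_on UNIV f" "\<forall>x. a < \<bar>x\<bar> \<longrightarrow> f x = 0" "smooth_on (- {0}) f"
    "continuous_on UNIV f" "continuous_on (- {0}) f"
  using assms by (auto simp: test_functions_on_iff
      intro: smooth_on_subset smooth_on_imp_continuous_on continuous_on_subset)

lemma sgn_ne: "y \<noteq> 0 \<Longrightarrow> sgn y \<in> {1, -1}" for y :: real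
  by (auto simp: sgn_if)

lemma eventually_zero_cts_test_function:
  assumes "f \<in> test_functions_on a" "\<sigma> \<in> {1, -1}" "v > 0"
  shows "eventually_zero_cts {v..} (fold_half \<sigma> f)"
  by (rule eventually_zero_cts_subset[OF eventually_zero_cts_fold_half_closed[of f a]])
     (use test_functions_onD[OF assms(1)] assms(2,3) in auto)

lemma Weyl_lincomb:
  assumes f: "f \<in> test_functions_on a" and g: "g \<in> test_functions_on a" and \<alpha>: "\<alpha> > -1/2"
  shows "Weyl \<alpha> (\<lambda>x. s * f x + t * g x) = (\<lambda>x. s * Weyl \<alpha> f x + t * Weyl \<alpha> g x)"
proof
  fix y
  show "Weyl \<alpha> (\<lambda>x. s * f x + t * g x) y = s * Weyl \<alpha> f y + t * Weyl \<alpha> g y"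
  proof (cases "y = 0")
    case False
    note W = Weyl_eq_frac_integral[OF test_functions_onD(5,2) \<alpha> False]
    have "fold_half (sgn y) (\<lambda>x. s * f x + t * g x)
        = (\<lambda>u. s * fold_half (sgn y) f u + t * fold_half (sgn y) g u)"
      by (simp add: fold_half_def fun_eq_iff)
    then have "frac_integral (\<alpha> + 1/2) (fold_half (sgn y) (\<lambda>x. s * f x + t * g x)) (y\<^sup>2)
        = s * frac_integral (\<alpha> + 1/2) (fold_half (sgn y) f) (y\<^sup>2)
          + t * frac_integral (\<alpha> + 1/2) (fold_half (sgn y) g) (y\<^sup>2)"
      using False sgn_ne[OF False] \<alpha>
      by (simp only:) (intro frac_integral_lincomb[of "y\<^sup>2"] eventually_zero_cts_test_function[OF f]
          eventually_zero_cts_test_function[OF g]; simp)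
    then show ?thesis
      unfolding W[OF f f] W[OF g g] W[OF test_functions_on_lincomb[OF f g] test_functions_on_lincomb[OF f g]]
      by (simp add: algebra_simps)
  qed simp
qed

text \<open>The operator c + x d/dx. The coefficient 1 is written out so that the body is literally
  a linear combination as in \<open>test_functions_on_lincomb\<close>.\<close>

definition euler_op :: "real \<Rightarrow> (real \<Rightarrow> complex) \<Rightarrow> real \<Rightarrow> complex" where
  "euler_op c f = (\<lambda>x. of_real c * f x + 1 * (of_real x * vderiv f x))"

lemma euler_op_test_functions_on: "f \<in> test_functions_on a \<Longrightarrow> euler_op c f \<in> test_functions_on a"
  unfolding euler_op_def by (intro test_functions_on_lincomb test_functions_on_euler)

lemma fold_half_funpow_ddx2:
  assumes F: "smooth_on (- {0}) F" "\<forall>x. a < \<bar>x\<bar> \<longrightarrow> F x = 0" and \<sigma>: "\<sigma> \<in> {1, -1}"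
  shows "eventually_zero_cts {0<..} (fold_half \<sigma> ((ddx2 ^^ n) F))"
    "u > 0 \<Longrightarrow> (fold_half \<sigma> ((ddx2 ^^ n) F) has_vector_derivative fold_half \<sigma> ((ddx2 ^^ Suc n) F) u) (at u)"
proof -
  show "eventually_zero_cts {0<..} (fold_half \<sigma> ((ddx2 ^^ n) F))"
    using smooth_on_imp_continuous_on[OF smooth_on_funpow_ddx2[OF F(1)]] funpow_ddx2_eq_0[OF F(2)] \<sigma>
    by (rule eventually_zero_cts_fold_half)
  show "(fold_half \<sigma> ((ddx2 ^^ n) F) has_vector_derivative fold_half \<sigma> ((ddx2 ^^ Suc n) F) u) (at u)" if "u > 0"
    using fold_half_has_vector_derivative[OF smooth_on_funpow_ddx2[OF F(1)] \<sigma> that] by simp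
qed

text \<open>The Weyl transform is homogeneous of degree \<open>2 \<alpha> + 1\<close>, hence commutes with the Euler
  operator up to a multiple of the identity.\<close>

lemma Weyl_has_vector_derivative:
  assumes f: "f \<in> test_functions_on a" and \<alpha>: "\<alpha> > -1/2" and y: "y \<noteq> 0"
  shows "(Weyl \<alpha> f has_vector_derivative inverse y *\<^sub>R Weyl \<alpha> (euler_op (2 * \<alpha> + 1) f) y) (at y)"
proof -
  define \<sigma> where "\<sigma> = sgn y"
  define \<beta> where "\<beta> = \<alpha> + 1/2"
  have \<sigma>: "\<sigma> \<in> {1, -1}" unfolding \<sigma>_def by (rule sgn_ne[OF y])
  have \<beta>: "\<beta> > 0" using \<alpha> by (simp add: \<beta>_def)
  have y2: "y\<^sup>2 > 0" using y by simp
  note f' = test_functions_onD[OF f]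
  let ?g = "fold_half \<sigma> f" and ?g' = "fold_half \<sigma> (ddx2 f)"
  have g': "eventually_zero_cts {0<..} ?g'"
    and der: "\<And>u. u > 0 \<Longrightarrow> (?g has_vector_derivative ?g' u) (at u)"
    and zero: "\<exists>A. \<forall>u\<ge>A. ?g u = 0"
    using fold_half_funpow_ddx2(1)[OF f'(3,2) \<sigma>, where n = 1]
      fold_half_funpow_ddx2(2)[OF f'(3,2) \<sigma>, where n = 0]
      eventually_zero_fold_half[OF f'(2) \<sigma>] by auto
  have 1: "((\<lambda>z. z\<^sup>2) has_vector_derivative 2 * y) (at y)"
    unfolding has_real_derivative_iff_has_vector_derivative[symmetric]
    by (auto intro!: derivative_eq_intros)
  have "((\<lambda>z. frac_integral \<beta> ?g (z\<^sup>2)) has_vector_derivative (2 * y) *\<^sub>R frac_integral \<beta> ?g' (y\<^sup>2)) (at y)"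
    using vector_diff_chain_at[OF 1 frac_integral_has_vector_derivative[OF g' der zero y2 \<beta>]]
    by (simp add: o_def)
  then have "((\<lambda>z. Weyl_factor \<alpha> *\<^sub>R frac_integral \<beta> ?g (z\<^sup>2)) has_vector_derivative
      Weyl_factor \<alpha> *\<^sub>R ((2 * y) *\<^sub>R frac_integral \<beta> ?g' (y\<^sup>2))) (at y)"
    by (rule bounded_linear.has_vector_derivative[OF bounded_linear_scaleR_right])
  then have D: "(Weyl \<alpha> f has_vector_derivative
      Weyl_factor \<alpha> *\<^sub>R ((2 * y) *\<^sub>R frac_integral \<beta> ?g' (y\<^sup>2))) (at y)"
  proof (rule has_vector_derivative_transform_within_open)
    \<comment> \<open>The open half-line through y, on which the sign, and hence the folded
      function, stays fixed.\<close>
    show "open {z. \<sigma> * z > 0}" by (intro open_Collect_less continuous_intros)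
    show "y \<in> {z. \<sigma> * z > 0}" using y by (simp add: \<sigma>_def sgn_mult_self_eq sgn_if)
    fix z assume "z \<in> {z. \<sigma> * z > 0}"
    then have "z \<noteq> 0" "sgn z = \<sigma>" using \<sigma> by (auto simp: sgn_if split: if_splits)
    then show "Weyl_factor \<alpha> *\<^sub>R frac_integral \<beta> ?g (z\<^sup>2) = Weyl \<alpha> f z"
      using Weyl_eq_frac_integral[OF f'(5,2) \<alpha>, of z] by (simp add: \<beta>_def)
  qed
  have "y\<^sup>2 *\<^sub>R frac_integral \<beta> ?g' (y\<^sup>2)
      = \<beta> *\<^sub>R frac_integral \<beta> ?g (y\<^sup>2) + frac_integral \<beta> (\<lambda>u. u *\<^sub>R ?g' u) (y\<^sup>2)"
    by (rule frac_integral_euler[OF g' der zero y2 \<beta>])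
  also have "\<dots> = of_real \<beta> * frac_integral \<beta> ?g (y\<^sup>2)
      + 1/2 * frac_integral \<beta> (fold_half \<sigma> (\<lambda>x. of_real x * vderiv f x)) (y\<^sup>2)"
  proof -
    \<comment> \<open>Here u d/du = (x d/dx) / 2, which trades the singular \<open>ddx2 f\<close>
      for a test function. The summand with coefficient 0 fits the shape of
      \<open>frac_integral_lincomb\<close>.\<close>
    have "frac_integral \<beta> (\<lambda>u. u *\<^sub>R ?g' u) (y\<^sup>2)
      = frac_integral \<beta> (\<lambda>u. 1/2 * fold_half \<sigma> (\<lambda>x. of_real x * vderiv f x) u + 0 * ?g u) (y\<^sup>2)"
    proof (rule frac_integral_cong)
      fix u assume "u > y\<^sup>2"
      then have u: "u > 0" using y2 by linarith
      define x where "x = \<sigma> * sqrt u"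
      have "u = x * x" "x \<noteq> 0" using u \<sigma> by (auto simp: x_def)
      then show "u *\<^sub>R ?g' u = 1/2 * fold_half \<sigma> (\<lambda>x. of_real x * vderiv f x) u + 0 * ?g u"
        unfolding fold_half_def x_def[symmetric] by (simp add: ddx2_def scaleR_conv_of_real field_simps)
    qed
    also have "\<dots> = 1/2 * frac_integral \<beta> (fold_half \<sigma> (\<lambda>x. of_real x * vderiv f x)) (y\<^sup>2)
        + 0 * frac_integral \<beta> ?g (y\<^sup>2)"
      by (intro frac_integral_lincomb[of "y\<^sup>2"] eventually_zero_cts_test_function[OF f]
          eventually_zero_cts_test_function[OF test_functions_on_euler[OF f]] \<sigma> y2 \<beta> order_refl)
    finally show ?thesis by (simp add: scaleR_conv_of_real)
  qed
  also have "\<dots> = 1/2 * (of_real (2 * \<beta>) * frac_integral \<beta> ?g (y\<^sup>2)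
      + 1 * frac_integral \<beta> (fold_half \<sigma> (\<lambda>x. of_real x * vderiv f x)) (y\<^sup>2))"
    by (simp add: algebra_simps)
  also have "\<dots> = 1/2 * frac_integral \<beta> (fold_half \<sigma> (euler_op (2 * \<alpha> + 1) f)) (y\<^sup>2)"
  proof -
    have "fold_half \<sigma> (euler_op (2 * \<alpha> + 1) f) = (\<lambda>u. of_real (2 * \<beta>) * ?g u + 1 * fold_half \<sigma> (\<lambda>x. of_real x * vderiv f x) u)"
      by (simp add: fold_half_def euler_op_def \<beta>_def fun_eq_iff)
    then show ?thesis
      by (simp only:) (subst frac_integral_lincomb[of "y\<^sup>2"], (intro eventually_zero_cts_test_function[OF f]
          eventually_zero_cts_test_function[OF test_functions_on_euler[OF f]] \<sigma> y2 \<beta> order_refl refl)+)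
  qed
  finally have key: "y\<^sup>2 *\<^sub>R frac_integral \<beta> ?g' (y\<^sup>2)
      = 1/2 * frac_integral \<beta> (fold_half \<sigma> (euler_op (2 * \<alpha> + 1) f)) (y\<^sup>2)" .
  \<comment> \<open>Writing 2 y as (2 / y) y^2 makes the Euler identity at v = y^2
    applicable.\<close>
  have "Weyl_factor \<alpha> *\<^sub>R ((2 * y) *\<^sub>R frac_integral \<beta> ?g' (y\<^sup>2))
      = (inverse y * 2 * Weyl_factor \<alpha>) *\<^sub>R (y\<^sup>2 *\<^sub>R frac_integral \<beta> ?g' (y\<^sup>2))"
    using y by (simp add: power2_eq_square)
  also have "\<dots> = inverse y *\<^sub>R (Weyl_factor \<alpha> *\<^sub>R frac_integral \<beta> (fold_half \<sigma> (euler_op (2 * \<alpha> + 1) f)) (y\<^sup>2))"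
    unfolding key by (simp add: scaleR_conv_of_real)
  also have "\<dots> = inverse y *\<^sub>R Weyl \<alpha> (euler_op (2 * \<alpha> + 1) f) y"
    unfolding \<sigma>_def \<beta>_def
    using Weyl_eq_frac_integral[OF test_functions_onD(5,2)[OF euler_op_test_functions_on[OF f]] \<alpha> y] by simp
  finally show ?thesis using D by simp
qed

text \<open>Differentiating y^(-n) contributes -n, which only lowers the constant of the Euler
  operator. Hence functions y^(-n) Weyl g with g a test function stay in this form, with n increased
  by one.\<close>

lemma Weyl_power_has_vector_derivative:
  assumes f: "f \<in> test_functions_on a" and \<alpha>: "\<alpha> > -1/2" and y: "y \<noteq> 0"
  shows "((\<lambda>y. inverse y ^ n *\<^sub>R Weyl \<alpha> f y) has_vector_derivative
    inverse y ^ Suc n *\<^sub>R Weyl \<alpha> (euler_op (2 * \<alpha> + 1 - real n) f) y) (at y)"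
proof -
  have 1: "((\<lambda>y. inverse y ^ n) has_field_derivative (- real n) * inverse y ^ Suc n) (at y)"
  proof (rule DERIV_cong)
    show "((\<lambda>x. inverse x ^ n) has_field_derivative
        of_nat n * (- (inverse y ^ Suc (Suc 0)) * inverse y ^ (n - Suc 0))) (at y)"
      by (intro DERIV_power DERIV_inverse y)
  qed (cases n; simp add: algebra_simps)
  have "euler_op (2 * \<alpha> + 1 - real n) f = (\<lambda>x. 1 * euler_op (2 * \<alpha> + 1) f x + of_real (- real n) * f x)"
    by (simp add: euler_op_def fun_eq_iff algebra_simps)
  then have eq: "Weyl \<alpha> (euler_op (2 * \<alpha> + 1 - real n) f) y
      = 1 * Weyl \<alpha> (euler_op (2 * \<alpha> + 1) f) y + of_real (- real n) * Weyl \<alpha> f y"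
    using Weyl_lincomb[OF euler_op_test_functions_on[OF f] f \<alpha>, of 1 "2 * \<alpha> + 1" "of_real (- real n)"] by simp
  have "inverse y ^ Suc n *\<^sub>R Weyl \<alpha> (euler_op (2 * \<alpha> + 1 - real n) f) y
     = inverse y ^ n *\<^sub>R (inverse y *\<^sub>R Weyl \<alpha> (euler_op (2 * \<alpha> + 1) f) y)
       + ((- real n) * inverse y ^ Suc n) *\<^sub>R Weyl \<alpha> f y"
    unfolding eq by (simp add: scaleR_conv_of_real algebra_simps)
  then show ?thesis
    using has_vector_derivative_scaleR[OF 1 Weyl_has_vector_derivative[OF f \<alpha> y]] by simp
qed

text \<open>The witness is again a test function on the same interval, so the limits in
  \<open>K0\<close> for every n reduce to the case n = 0 for another function.\<close>

lemma Weyl_derivatives: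
  assumes f: "f \<in> test_functions_on a" and \<alpha>: "\<alpha> > -1/2"
  shows "\<exists>g\<in>test_functions_on a. \<forall>y. y \<noteq> 0 \<longrightarrow>
     (vderiv ^^ n) (Weyl \<alpha> f) y = inverse y ^ n *\<^sub>R Weyl \<alpha> g y \<and>
     (vderiv ^^ n) (Weyl \<alpha> f) differentiable at y"
proof (induction n)
  case 0
  show ?case
    using f Weyl_has_vector_derivative[OF f \<alpha>] by (auto intro!: bexI[of _ f] differentiableI_vector)
next
  case (Suc n)
  then obtain g where g: "g \<in> test_functions_on a"
    "\<And>y. y \<noteq> 0 \<Longrightarrow> (vderiv ^^ n) (Weyl \<alpha> f) y = inverse y ^ n *\<^sub>R Weyl \<alpha> g y" by blast
  let ?h = "euler_op (2 * \<alpha> + 1 - real n) g"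
  have h: "?h \<in> test_functions_on a" using g(1) by (rule euler_op_test_functions_on)
  have eq: "(vderiv ^^ Suc n) (Weyl \<alpha> f) y = inverse y ^ Suc n *\<^sub>R Weyl \<alpha> ?h y" if "y \<noteq> 0" for y
  proof -
    have "((vderiv ^^ n) (Weyl \<alpha> f) has_vector_derivative inverse y ^ Suc n *\<^sub>R Weyl \<alpha> ?h y) (at y)"
      by (rule has_vector_derivative_transform_within_open[OF
            Weyl_power_has_vector_derivative[OF g(1) \<alpha> that], where S = "- {0}"])
         (use that g(2) in auto)
    then show ?thesis by (simp add: vderiv_def[of "(vderiv ^^ n) _"] vector_derivative_at)
  qed
  have "((vderiv ^^ Suc n) (Weyl \<alpha> f) has_vector_derivative
      inverse y ^ Suc (Suc n) *\<^sub>R Weyl \<alpha> (euler_op (2 * \<alpha> + 1 - real (Suc n)) ?h) y) (at y)" if "y \<noteq> 0" for y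
    by (rule has_vector_derivative_transform_within_open[OF
          Weyl_power_has_vector_derivative[OF h \<alpha> that], where S = "- {0}"])
       (use that eq in auto)
  with h eq show ?case by (blast intro: differentiableI_vector)
qed

text \<open>On each side of 0 the transform is a fixed fractional integral, continuous on
  \<open>{0..}\<close>, taken at y^2. The two sides use different \<sigma>, so the limits may
  differ.\<close>

lemma Weyl_limits:
  assumes f: "f \<in> test_functions_on a" and \<alpha>: "\<alpha> > -1/2"
  shows "\<exists>l. (Weyl \<alpha> f \<longlongrightarrow> l) (at_right 0)" "\<exists>l. (Weyl \<alpha> f \<longlongrightarrow> l) (at_left 0)"
proof -
  note f' = test_functions_onD[OF f]
  let ?F = "\<lambda>\<sigma>. frac_integral (\<alpha> + 1/2) (fold_half \<sigma> f)"
  have *: "((\<lambda>y. Weyl_factor \<alpha> *\<^sub>R ?F \<sigma> (y\<^sup>2)) \<longlongrightarrow> Weyl_factor \<alpha> *\<^sub>R ?F \<sigma> (0\<^sup>2)) (at 0 within S)"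
    if "\<sigma> \<in> {1, -1}" for \<sigma> S
  proof -
    have "continuous_on {0..} (?F \<sigma>)"
      using \<alpha> by (intro continuous_on_frac_integral eventually_zero_cts_fold_half_closed[OF f'(4,2) that]) simp
    then have "continuous_on UNIV (\<lambda>y. ?F \<sigma> (y\<^sup>2))"
      by (rule continuous_on_compose2) (auto intro!: continuous_intros)
    then have "isCont (\<lambda>y. ?F \<sigma> (y\<^sup>2)) 0"
      by (simp add: continuous_on_eq_continuous_at)
    then have "((\<lambda>y. ?F \<sigma> (y\<^sup>2)) \<longlongrightarrow> ?F \<sigma> (0\<^sup>2)) (at 0)"
      by (simp add: isCont_def)
    then show ?thesis
      by (intro tendsto_intros) (rule tendsto_within_subset, auto)
  qed
  have ev: "eventually (\<lambda>y. Weyl_factor \<alpha> *\<^sub>R ?F 1 (y\<^sup>2) = Weyl \<alpha> f y) (at_right 0)"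
    using Weyl_eq_frac_integral[OF f'(5,2) \<alpha>] by (intro eventually_at_rightI[of 0 1]) auto
  show "\<exists>l. (Weyl \<alpha> f \<longlongrightarrow> l) (at_right 0)"
    using Lim_transform_eventually[OF *[of 1] ev] by blast
  have ev: "eventually (\<lambda>y. Weyl_factor \<alpha> *\<^sub>R ?F (-1) (y\<^sup>2) = Weyl \<alpha> f y) (at_left 0)"
    using Weyl_eq_frac_integral[OF f'(5,2) \<alpha>] by (intro eventually_at_leftI[of "-1" 0]) auto
  show "\<exists>l. (Weyl \<alpha> f \<longlongrightarrow> l) (at_left 0)"
    using Lim_transform_eventually[OF *[of "-1"] ev] by blast
qed

lemma smooth_on_Weyl:
  assumes "f \<in> test_functions_on a" "\<alpha> > -1/2"
  shows "smooth_on (- {0}) (Weyl \<alpha> f)"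
  using Weyl_derivatives[OF assms] unfolding smooth_on_def by blast

lemma Weyl_in_K0:
  assumes f: "f \<in> test_functions_on a" and \<alpha>: "\<alpha> > -1/2"
  shows "Weyl \<alpha> f \<in> K0" "fun_support (Weyl \<alpha> f) \<subseteq> {-a..a}"
proof -
  show supp: "fun_support (Weyl \<alpha> f) \<subseteq> {-a..a}"
    unfolding fun_support_subset_iff using Weyl_eq_0[OF test_functions_onD(2)[OF f]] by blast
  have "(\<exists>l. ((\<lambda>y. y ^ n *\<^sub>R (vderiv ^^ n) (Weyl \<alpha> f) y) \<longlongrightarrow> l) (at_right 0)) \<and>
      (\<exists>l. ((\<lambda>y. y ^ n *\<^sub>R (vderiv ^^ n) (Weyl \<alpha> f) y) \<longlongrightarrow> l) (at_left 0))" for n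
  proof -
    obtain g where g: "g \<in> test_functions_on a"
      "\<And>y. y \<noteq> 0 \<Longrightarrow> (vderiv ^^ n) (Weyl \<alpha> f) y = inverse y ^ n *\<^sub>R Weyl \<alpha> g y"
      using Weyl_derivatives[OF f \<alpha>, of n] by blast
    have "Weyl \<alpha> g y = y ^ n *\<^sub>R (vderiv ^^ n) (Weyl \<alpha> f) y" if "y \<noteq> 0" for y
      using that g(2)[OF that] by (simp add: power_inverse)
    then have ev: "eventually (\<lambda>y. Weyl \<alpha> g y = y ^ n *\<^sub>R (vderiv ^^ n) (Weyl \<alpha> f) y) (at 0 within S)" for S
      by (auto simp: eventually_at_filter)
    show ?thesis
      using Weyl_limits[OF g(1) \<alpha>] Lim_transform_eventually[OF _ ev] by blast
  qed
  then show "Weyl \<alpha> f \<in> K0"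
    unfolding K0_def using smooth_on_Weyl[OF f \<alpha>] bounded_subset[OF bounded_closed_interval supp] by simp
qed

section \<open>Isomorphisms of inductive limits\<close>

text \<open>By linearity and q (T f) = c p f, the ball of radius c \<epsilon> around T f is
  contained in the image of the ball of radius \<epsilon> around f.\<close>

lemma openin_image_seminorm_topology:
  assumes lin: "\<And>f g s t. f \<in> E \<Longrightarrow> g \<in> E \<Longrightarrow> T (\<lambda>x. s * f x + t * g x) = (\<lambda>x. s * T f x + t * T g x)"
    and sub: "\<And>f g s t. f \<in> E \<Longrightarrow> g \<in> E \<Longrightarrow> (\<lambda>x. s * f x + t * g x) \<in> E"
    and img: "T ` E = F" and "c > 0" and semi: "\<And>n f. f \<in> E \<Longrightarrow> q n (T f) = c * p n f"
    and V: "openin (seminorm_topology E p) V"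
  shows "openin (seminorm_topology F q) (T ` V)"
  unfolding openin_seminorm_topology
proof (intro conjI ballI)
  have VE: "V \<subseteq> E" using V by (simp add: openin_seminorm_topology)
  then show "T ` V \<subseteq> F" using img by blast
  fix f' assume "f' \<in> T ` V"
  then obtain f where f: "f \<in> V" "f' = T f" by blast
  obtain n \<epsilon> where n: "\<epsilon> > 0" "{g\<in>E. \<forall>i\<le>n. p i (\<lambda>x. g x - f x) < \<epsilon>} \<subseteq> V"
    using V f(1) unfolding openin_seminorm_topology by blast
  have "h \<in> T ` V" if h: "h \<in> F" "\<forall>i\<le>n. q i (\<lambda>x. h x - f' x) < c * \<epsilon>" for h
  proof -
    obtain g where g: "g \<in> E" "h = T g" using h(1) img by blast
    have fE: "f \<in> E" using f VE by blast
    have "T (\<lambda>x. g x - f x) = (\<lambda>x. h x - f' x)"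
      using lin[OF g(1) fE, of 1 "-1"] g f by simp
    moreover have "(\<lambda>x. g x - f x) \<in> E" using sub[OF g(1) fE, of 1 "-1"] by simp
    ultimately have "q i (\<lambda>x. h x - f' x) = c * p i (\<lambda>x. g x - f x)" for i
      using semi[of "\<lambda>x. g x - f x" i] by simp
    then have "\<forall>i\<le>n. p i (\<lambda>x. g x - f x) < \<epsilon>" using h(2) \<open>c > 0\<close> by simp
    then show ?thesis using n(2) g by blast
  qed
  then show "\<exists>n. \<exists>\<epsilon>>0. {g \<in> F. \<forall>i\<le>n. q i (\<lambda>x. g x - f' x) < \<epsilon>} \<subseteq> T ` V"
    using n(1) \<open>c > 0\<close> by (intro exI[of _ n] exI[of _ "c * \<epsilon>"]) auto
qed

lemma lincomb_in_Union:
  fixes E :: "real \<Rightarrow> (real \<Rightarrow> complex) set"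
  assumes mono: "\<And>a b. a \<le> b \<Longrightarrow> E a \<subseteq> E b"
    and sub: "\<And>a f g s t. a \<ge> 0 \<Longrightarrow> f \<in> E a \<Longrightarrow> g \<in> E a \<Longrightarrow> (\<lambda>x. s * f x + t * g x) \<in> E a"
    and fg: "f \<in> (\<Union>a\<in>{0..}. E a)" "g \<in> (\<Union>a\<in>{0..}. E a)"
  shows "(\<lambda>x. s * f x + t * g x) \<in> (\<Union>a\<in>{0..}. E a)"
proof -
  obtain a b where "a \<ge> 0" "b \<ge> 0" "f \<in> E a" "g \<in> E b" using fg by auto
  then have "f \<in> E (max a b)" "g \<in> E (max a b)" "max a b \<ge> 0"
    using mono[of a "max a b"] mono[of b "max a b"] by auto
  then show ?thesis using sub by fastforce
qed

text \<open>Formulated for images so that it applies twice: to T, and with E and F exchanged to the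
  inverse of T.\<close>

lemma openin_image_inductive_limit:
  fixes E F :: "real \<Rightarrow> (real \<Rightarrow> complex) set" and T :: "(real \<Rightarrow> complex) \<Rightarrow> real \<Rightarrow> complex"
  defines "EE \<equiv> \<Union>a\<in>{0..}. E a"
  assumes mono: "\<And>a b. a \<le> b \<Longrightarrow> E a \<subseteq> E b"
    and zero: "\<And>a. a \<ge> 0 \<Longrightarrow> (\<lambda>x. 0) \<in> E a"
    and lin: "\<And>f g s t. f \<in> EE \<Longrightarrow> g \<in> EE \<Longrightarrow> T (\<lambda>x. s * f x + t * g x) = (\<lambda>x. s * T f x + t * T g x)"
    and sub: "\<And>a f g s t. a \<ge> 0 \<Longrightarrow> f \<in> E a \<Longrightarrow> g \<in> E a \<Longrightarrow> (\<lambda>x. s * f x + t * g x) \<in> E a"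
    and inj: "inj_on T EE"
    and img: "\<And>a. a \<ge> 0 \<Longrightarrow> T ` E a = F a"
    and "c > 0" and semi: "\<And>a n f. a \<ge> 0 \<Longrightarrow> f \<in> E a \<Longrightarrow> q a n (T f) = c * p a n f"
    and W: "openin (inductive_limit_topology (\<lambda>a. seminorm_topology (E a) (p a))) W"
  shows "openin (inductive_limit_topology (\<lambda>a. seminorm_topology (F a) (q a))) (T ` W)"
proof -
  define FF where "FF = (\<Union>a\<in>{0..}. F a)"
  have FF: "FF = T ` EE" unfolding FF_def EE_def image_UN by (rule SUP_cong) (simp_all add: img)
  have subE: "(\<lambda>x. s * f x + t * g x) \<in> EE" if "f \<in> EE" "g \<in> EE" for f g s t
    using lincomb_in_Union[of E, OF mono sub] that unfolding EE_def by blast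
  have zeroE: "(\<lambda>x. 0) \<in> EE" using zero[of 0] by (auto simp: EE_def)
  have T0: "T (\<lambda>x. 0) = (\<lambda>x. 0)" using lin[OF zeroE zeroE, of 0 0] by simp
  have WE: "W \<subseteq> EE"
    and Wn: "\<And>f. f \<in> W \<Longrightarrow> \<exists>U. absolutely_convex U \<and> (\<forall>a\<ge>0. zero_neighbourhood (seminorm_topology (E a) (p a)) U) \<and>
       {g\<in>EE. (\<lambda>x. g x - f x) \<in> U} \<subseteq> W"
    using W unfolding openin_inductive_limit_topology by (auto simp: EE_def)
  have "\<exists>U. absolutely_convex U \<and> (\<forall>a\<ge>0. zero_neighbourhood (seminorm_topology (F a) (q a)) U) \<and>
       {g\<in>FF. (\<lambda>x. g x - f' x) \<in> U} \<subseteq> T ` W" if f': "f' \<in> T ` W" for f'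
  proof -
    obtain f where f: "f \<in> W" "f' = T f" using f' by blast
    obtain U where U: "absolutely_convex U"
      "\<And>a. a \<ge> 0 \<Longrightarrow> zero_neighbourhood (seminorm_topology (E a) (p a)) U"
      "{g\<in>EE. (\<lambda>x. g x - f x) \<in> U} \<subseteq> W" using Wn[OF f(1)] by blast
    \<comment> \<open>U may extend beyond the union, whereas T is known to be linear and injective
      only on \<open>EE\<close>; hence the intersection.\<close>
    define U' where "U' = T ` (U \<inter> EE)"
    have "absolutely_convex U'"
      unfolding absolutely_convex_def
    proof (intro ballI allI impI)
      fix g' h' s t assume *: "g' \<in> U'" "h' \<in> U'" "cmod s + cmod t \<le> 1"
      then obtain g h where gh: "g \<in> U" "h \<in> U" "g \<in> EE" "h \<in> EE" "g' = T g" "h' = T h"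
        by (auto simp: U'_def)
      have "(\<lambda>x. s * g x + t * h x) \<in> U \<inter> EE"
        using U(1) gh * subE unfolding absolutely_convex_def by blast
      moreover have "T (\<lambda>x. s * g x + t * h x) = (\<lambda>x. s * g' x + t * h' x)"
        using lin gh by simp
      ultimately show "(\<lambda>x. s * g' x + t * h' x) \<in> U'"
        unfolding U'_def by (intro image_eqI) (rule sym)
    qed
    moreover have "zero_neighbourhood (seminorm_topology (F a) (q a)) U'" if a: "a \<ge> 0" for a
    proof -
      obtain V where V: "openin (seminorm_topology (E a) (p a)) V" "(\<lambda>x. 0) \<in> V" "V \<subseteq> U"
        using U(2)[OF a] unfolding zero_neighbourhood_def by blast
      have EaEE: "E a \<subseteq> EE" using a by (auto simp: EE_def)
      have "openin (seminorm_topology (F a) (q a)) (T ` V)"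
      proof (rule openin_image_seminorm_topology[OF _ _ img[OF a] \<open>c > 0\<close> _ V(1)])
        show "T (\<lambda>x. s * f x + t * g x) = (\<lambda>x. s * T f x + t * T g x)"
          if "f \<in> E a" "g \<in> E a" for f g s t using lin that EaEE by blast
        show "q a n (T f) = c * p a n f" if "f \<in> E a" for n f
          using semi[OF a that] .
        show "(\<lambda>x. s * f x + t * g x) \<in> E a" if "f \<in> E a" "g \<in> E a" for f g s t
          using sub[OF a that] .
      qed
      moreover have "(\<lambda>x. 0) \<in> T ` V" using V(2) T0 by force
      moreover have "V \<subseteq> E a" using V(1) by (simp add: openin_seminorm_topology)
      then have "T ` V \<subseteq> U'" using V(3) EaEE by (auto simp: U'_def)
      ultimately show ?thesis unfolding zero_neighbourhood_def by blast
    qed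
    moreover have "{g\<in>FF. (\<lambda>x. g x - f' x) \<in> U'} \<subseteq> T ` W"
    proof
      fix h assume "h \<in> {g\<in>FF. (\<lambda>x. g x - f' x) \<in> U'}"
      then obtain g u where g: "g \<in> EE" "h = T g" and u: "u \<in> U" "u \<in> EE" "(\<lambda>x. h x - f' x) = T u"
        unfolding FF U'_def by blast
      have fE: "f \<in> EE" using f WE by blast
      have "T (\<lambda>x. g x - f x) = T u"
        using lin[OF g(1) fE, of 1 "-1"] g f u by simp
      moreover have "(\<lambda>x. g x - f x) \<in> EE" using subE[OF g(1) fE, of 1 "-1"] by simp
      \<comment> \<open>Injectivity is what allows a return from T (g - f) in T (U) to g - f in
        U.\<close>
      ultimately have "(\<lambda>x. g x - f x) = u" using inj u(2) by (auto dest: inj_onD)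
      then have "g \<in> W" using U(3) g(1) u(1) by blast
      then show "h \<in> T ` W" using g(2) by blast
    qed
    ultimately show ?thesis by blast
  qed
  moreover have "T ` W \<subseteq> FF" using WE FF by blast
  ultimately show ?thesis
    unfolding openin_inductive_limit_topology by (auto simp: FF_def)
qed

text \<open>T is open by the preceding lemma. Continuity of T is openness of its inverse S, which
  satisfies the same hypotheses with the constant 1 / c.\<close>

lemma topological_isomorphism_inductive_limit:
  fixes E F :: "real \<Rightarrow> (real \<Rightarrow> complex) set" and T :: "(real \<Rightarrow> complex) \<Rightarrow> real \<Rightarrow> complex"
  defines "EE \<equiv> \<Union>a\<in>{0..}. E a"
  assumes mono: "\<And>a b. a \<le> b \<Longrightarrow> E a \<subseteq> E b"
    and monoF: "\<And>a b. a \<le> b \<Longrightarrow> F a \<subseteq> F b"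
    and zero: "\<And>a. a \<ge> 0 \<Longrightarrow> (\<lambda>x. 0) \<in> E a"
    and lin: "\<And>f g s t. f \<in> EE \<Longrightarrow> g \<in> EE \<Longrightarrow> T (\<lambda>x. s * f x + t * g x) = (\<lambda>x. s * T f x + t * T g x)"
    and sub: "\<And>a f g s t. a \<ge> 0 \<Longrightarrow> f \<in> E a \<Longrightarrow> g \<in> E a \<Longrightarrow> (\<lambda>x. s * f x + t * g x) \<in> E a"
    and inj: "inj_on T EE"
    and img: "\<And>a. a \<ge> 0 \<Longrightarrow> T ` E a = F a"
    and "c > 0" and semi: "\<And>a n f. a \<ge> 0 \<Longrightarrow> f \<in> E a \<Longrightarrow> q a n (T f) = c * p a n f"
  shows "topological_isomorphism (inductive_limit_topology (\<lambda>a. seminorm_topology (E a) (p a)))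
    (inductive_limit_topology (\<lambda>a. seminorm_topology (F a) (q a))) T"
    (is "topological_isomorphism ?X ?Y T")
proof -
  define FF where "FF = (\<Union>a\<in>{0..}. F a)"
  have FF: "FF = T ` EE" unfolding FF_def EE_def image_UN by (rule SUP_cong) (simp_all add: img)
  have zeroF: "(\<lambda>x. 0) \<in> F a" if "a \<ge> 0" for a
  proof -
    have "(\<lambda>x. 0) \<in> EE" using zero[OF that] that by (auto simp: EE_def)
    then have "T (\<lambda>x. 0) = (\<lambda>x. 0)" using lin[of "\<lambda>x. 0" "\<lambda>x. 0" 0 0] by simp
    then show ?thesis using zero[OF that] img[OF that] by force
  qed
  have topX: "topspace ?X = EE"
    by (subst topspace_inductive_limit_topology) (auto simp: zero EE_def)
  have topY: "topspace ?Y = FF"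
    by (subst topspace_inductive_limit_topology) (auto simp: zeroF FF_def)
  have subE: "(\<lambda>x. s * f x + t * g x) \<in> EE" if "f \<in> EE" "g \<in> EE" for f g s t
    using lincomb_in_Union[of E, OF mono sub] that unfolding EE_def by blast
  have EaEE: "E a \<subseteq> EE" if "a \<ge> 0" for a using that by (auto simp: EE_def)
  define S where "S = the_inv_into EE T"
  have ST: "S (T f) = f" if "f \<in> EE" for f
    unfolding S_def using inj that by (rule the_inv_into_f_f)
  have open_map: "open_map ?X ?Y T"
    unfolding open_map_def
  proof (intro allI impI)
    fix W assume "openin ?X W"
    then show "openin ?Y (T ` W)"
      by (rule openin_image_inductive_limit[where E = E and F = F and T = T and p = p and q = q and c = c,
            folded EE_def, rotated -1]) fact+
  qed
  have continuous: "continuous_map ?X ?Y T"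
    unfolding continuous_map topX topY
  proof (intro conjI allI impI)
    show "T ` EE \<subseteq> FF" using FF by blast
    fix W assume W: "openin ?Y W"
    have "openin ?X (S ` W)"
    proof (rule openin_image_inductive_limit[where E = F and F = E and T = S and p = q and q = p
          and c = "1 / c", folded FF_def])
      show "S (\<lambda>x. s * f x + t * g x) = (\<lambda>x. s * S f x + t * S g x)" if "f \<in> FF" "g \<in> FF" for f g s t
      proof -
        obtain f0 g0 where fg: "f0 \<in> EE" "f = T f0" "g0 \<in> EE" "g = T g0" using \<open>f \<in> FF\<close> \<open>g \<in> FF\<close> FF by blast
        then have "S (T (\<lambda>x. s * f0 x + t * g0 x)) = (\<lambda>x. s * f0 x + t * g0 x)"
          by (intro ST subE)
        then show ?thesis using fg lin by (simp add: ST)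
      qed
      show "(\<lambda>x. s * f x + t * g x) \<in> F a" 
        if a: "a \<ge> 0" and "f \<in> F a" "g \<in> F a" for a f g s t
      proof -
        obtain f0 g0 where fg: "f0 \<in> E a" "f = T f0" "g0 \<in> E a" "g = T g0"
          using \<open>f \<in> F a\<close> \<open>g \<in> F a\<close> img[OF a] by blast
        have "(\<lambda>x. s * f x + t * g x) = T (\<lambda>x. s * f0 x + t * g0 x)"
          unfolding fg by (rule lin[symmetric]) (use fg EaEE[OF a] in auto)
        then show ?thesis
          unfolding img[OF a, symmetric] by (rule image_eqI[OF _ sub[OF a fg(1,3)]])
      qed
      show "inj_on S FF" unfolding FF by (auto simp: inj_on_def ST)
      show "S ` F a = E a" if "a \<ge> 0" for a
        unfolding img[OF that, symmetric] using ST EaEE[OF that] by (force simp: image_image)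
      show "p a n (S f) = 1 / c * q a n f" if a: "a \<ge> 0" "f \<in> F a" for a n f
      proof -
        obtain f0 where f0: "f0 \<in> E a" "f = T f0" using a(2) unfolding img[OF a(1), symmetric] by blast
        then have "S f = f0" using ST EaEE[OF a(1)] by auto
        then show ?thesis using semi[OF a(1) f0(1), of n] f0 \<open>c > 0\<close> by simp
      qed
    qed (use monoF zeroF W \<open>c > 0\<close> in simp_all)
    \<comment> \<open>By bijectivity, the preimage of W under T is its image under S.\<close>
    moreover have "S ` W = {x \<in> EE. T x \<in> W}"
    proof -
      have "W \<subseteq> T ` EE" using openin_subset[OF W] topY FF by simp
      then show ?thesis using ST by force
    qed
    ultimately show "openin ?X {x \<in> EE. T x \<in> W}" by simp
  qed
  have "homeomorphic_map ?X ?Y T"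
    by (rule bijective_open_imp_homeomorphic_map[OF continuous open_map]) (simp_all add: topX topY FF inj)
  then show ?thesis
    unfolding topological_isomorphism_def topX using lin by blast
qed

section \<open>Inversion\<close>

text \<open>V without its constant and without extension to 0. Off 0 it is also the function whose
  extension defines \<open>Delta\<close> and its seminorms, once the weight |x|^(2r-1) is removed,
  so one formula serves inversion, range and topology.\<close>

definition Weyl_inverse_op :: "real \<Rightarrow> (real \<Rightarrow> complex) \<Rightarrow> real \<Rightarrow> complex" where
  "Weyl_inverse_op \<alpha> F x =
    (if index_r \<alpha> = 1/2 then (ddx2 ^^ (index_k \<alpha> + 1)) F x
     else radial_integral (1/2 - index_r \<alpha>) ((ddx2 ^^ (index_k \<alpha> + 1)) F) x)"

text \<open>The sign and the factorial come from k + 1 integrations by parts,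
  \<open>Weyl_factor\<close> from the transform, 1/2 from the substitution in the second integral,
  and \<open>Beta\<close> from composing orders 1/2 - r and \<alpha> + 1/2.\<close>

definition Weyl_inverse_factor :: "real \<Rightarrow> real" where
  "Weyl_inverse_factor \<alpha> = (-1) ^ (index_k \<alpha> + 1) * fact (index_k \<alpha>) * Weyl_factor \<alpha> *
    (if index_r \<alpha> = 1/2 then 1 else (1 / 2) * Beta (1/2 - index_r \<alpha>) (\<alpha> + 1/2))"

lemma Weyl_inverse_factor_nonzero:
  assumes \<alpha>: "\<alpha> > -1/2"
  shows "Weyl_inverse_factor \<alpha> \<noteq> 0"
proof -
  have "Beta (1/2 - index_r \<alpha>) (\<alpha> + 1/2) > 0" if "index_r \<alpha> \<noteq> 1/2"
    unfolding Beta_def using index_r_bounds[OF \<alpha>] that \<alpha>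
    by (intro divide_pos_pos mult_pos_pos Gamma_real_pos) auto
  then show ?thesis using Weyl_factor_pos[OF \<alpha>] by (auto simp: Weyl_inverse_factor_def)
qed

lemma Weyl_inverse_op_Weyl:
  assumes f: "f \<in> test_functions_on a" and \<alpha>: "\<alpha> > -1/2" and x: "x \<noteq> 0"
  shows "Weyl_inverse_op \<alpha> (Weyl \<alpha> f) x = Weyl_inverse_factor \<alpha> *\<^sub>R f x"
proof -
  define \<sigma> where "\<sigma> = sgn x"
  define \<beta> where "\<beta> = \<alpha> + 1/2"
  define k where "k = index_k \<alpha>"
  define r where "r = index_r \<alpha>"
  define G where "G n = fold_half \<sigma> ((ddx2 ^^ n) f)" for n
  have \<sigma>: "\<sigma> \<in> {1, -1}" unfolding \<sigma>_def by (rule sgn_ne[OF x])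
  have \<beta>: "\<beta> > 0" using \<alpha> by (simp add: \<beta>_def)
  have r: "-1/2 < r" "r \<le> 1/2" "\<alpha> = real k + r"
    unfolding k_def r_def using index_r_bounds[OF \<alpha>] by auto
  have x2: "x\<^sup>2 > 0" using x by simp
  then have sub: "{x\<^sup>2..} \<subseteq> {0<..}"
    by (meson atLeast_iff greaterThan_iff order_less_le_trans subsetI)
  note f' = test_functions_onD[OF f]
  note W' = smooth_on_Weyl[OF f \<alpha>] allI[OF impI[OF Weyl_eq_0[OF f'(2)]]]
  note G = fold_half_funpow_ddx2(1)[OF f'(3,2) \<sigma>, folded G_def]
    fold_half_funpow_ddx2(2)[OF f'(3,2) \<sigma>, folded G_def]
  have zero: "\<exists>A. \<forall>u\<ge>A. G n u = 0" for n using G(1) by (simp add: eventually_zero_cts_def)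
  \<comment> \<open>The iterates of d/du pass inside the fractional integral one at a time, by
    uniqueness of the derivative at u.\<close>
  have W: "fold_half \<sigma> ((ddx2 ^^ n) (Weyl \<alpha> f)) u = Weyl_factor \<alpha> *\<^sub>R frac_integral \<beta> (G n) u" if "u > 0" for n u
    using that
  proof (induction n arbitrary: u)
    case 0
    then show ?case using fold_half_Weyl[OF f'(5,2) \<alpha> 0 \<sigma>] by (simp add: G_def \<beta>_def)
  next
    case (Suc n)
    have "((\<lambda>u. Weyl_factor \<alpha> *\<^sub>R frac_integral \<beta> (G n) u) has_vector_derivative
        Weyl_factor \<alpha> *\<^sub>R frac_integral \<beta> (G (Suc n)) u) (at u)"
      by (intro bounded_linear.has_vector_derivative[OF bounded_linear_scaleR_right]
          frac_integral_has_vector_derivative G zero Suc.prems \<beta>)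
    then have "(fold_half \<sigma> ((ddx2 ^^ n) (Weyl \<alpha> f)) has_vector_derivative
        Weyl_factor \<alpha> *\<^sub>R frac_integral \<beta> (G (Suc n)) u) (at u)"
      by (rule has_vector_derivative_transform_within_open[where S = "{0<..}"])
         (use Suc in auto)
    then show ?case
      using vector_derivative_unique_at[OF fold_half_funpow_ddx2(2)[OF W' \<sigma> Suc.prems]] by blast
  qed
  have iter: "frac_integral (real k + 1) (G (Suc k)) (x\<^sup>2) = ((-1) ^ (k + 1) * fact k) *\<^sub>R f x"
    using frac_integral_iterated_deriv[of G, OF G x2]
    by (simp add: G_def \<sigma>_def fold_half_sgn_power2)
  show ?thesis
  proof (cases "r = 1/2")
    case True
    then have "\<beta> = real k + 1" using r by (simp add: \<beta>_def)
    then have "(ddx2 ^^ (k + 1)) (Weyl \<alpha> f) x = Weyl_factor \<alpha> *\<^sub>R (((-1) ^ (k + 1) * fact k) *\<^sub>R f x)"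
      using W[OF x2, of "Suc k"] iter by (simp add: \<sigma>_def fold_half_sgn_power2 del: funpow.simps)
    then show ?thesis
      using True unfolding Weyl_inverse_op_def Weyl_inverse_factor_def k_def r_def
      by (simp add: mult.commute del: funpow.simps)
  next
    case False
    define \<gamma> where "\<gamma> = 1/2 - r"
    \<comment> \<open>The order \<gamma> complements \<beta> to the integer k + 1, exactly the
      number of derivatives to be undone.\<close>
    have \<gamma>: "\<gamma> > 0" "\<gamma> + \<beta> = real k + 1" using False r by (auto simp: \<gamma>_def \<beta>_def)
    have "radial_integral \<gamma> ((ddx2 ^^ (k + 1)) (Weyl \<alpha> f)) x
        = (1 / 2) *\<^sub>R frac_integral \<gamma> (fold_half \<sigma> ((ddx2 ^^ (k + 1)) (Weyl \<alpha> f))) (x\<^sup>2)"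
      unfolding \<sigma>_def
      by (rule radial_integral_eq_frac_integral[OF
            smooth_on_imp_continuous_on[OF smooth_on_funpow_ddx2[OF W'(1)]]
            funpow_ddx2_eq_0[OF W'(2)] \<gamma>(1) x])
    also have "frac_integral \<gamma> (fold_half \<sigma> ((ddx2 ^^ (k + 1)) (Weyl \<alpha> f))) (x\<^sup>2)
        = frac_integral \<gamma> (\<lambda>u. of_real (Weyl_factor \<alpha>) * frac_integral \<beta> (G (k + 1)) u) (x\<^sup>2)"
    proof (rule frac_integral_cong)
      fix u assume "u > x\<^sup>2"
      then have "u > 0" using x2 by linarith
      then show "fold_half \<sigma> ((ddx2 ^^ (k + 1)) (Weyl \<alpha> f)) u = of_real (Weyl_factor \<alpha>) * frac_integral \<beta> (G (k + 1)) u"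
        using W by (simp add: scaleR_conv_of_real del: funpow.simps)
    qed
    also have "\<dots> = of_real (Weyl_factor \<alpha>) * frac_integral \<gamma> (frac_integral \<beta> (G (k + 1))) (x\<^sup>2)"
    proof -
      have "eventually_zero_cts {x\<^sup>2..} (frac_integral \<beta> (G (k + 1)))"
        by (intro eventually_zero_cts_frac_integral \<beta> eventually_zero_cts_subset[OF G(1)])
           (rule sub)
      from frac_integral_lincomb[OF this this order_refl \<gamma>(1), of "of_real (Weyl_factor \<alpha>)" 0]
      show ?thesis by simp
    qed
    also have "frac_integral \<gamma> (frac_integral \<beta> (G (k + 1))) (x\<^sup>2)
        = Beta \<gamma> \<beta> *\<^sub>R frac_integral (real k + 1) (G (k + 1)) (x\<^sup>2)"
      unfolding \<gamma>(2)[symmetric]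
      by (intro frac_integral_frac_integral[of "x\<^sup>2"] \<beta> \<gamma> eventually_zero_cts_subset[OF G(1)] sub order_refl)
    also have "frac_integral (real k + 1) (G (k + 1)) (x\<^sup>2) = ((-1) ^ (k + 1) * fact k) *\<^sub>R f x"
      using iter by simp
    finally show ?thesis
      using False unfolding Weyl_inverse_op_def Weyl_inverse_factor_def k_def r_def \<gamma>_def \<beta>_def
      by (simp add: scaleR_conv_of_real del: funpow.simps)
  qed
qed

text \<open>For f not known to be a transform; this yields surjectivity. The derivatives are already
  innermost, so the semigroup law applies at once. As f may be singular at 0, the integrals are
  taken at y^2 > 0; at y = 0 the normalisation \<open>f 0 = 0\<close> decides.\<close>

lemma Weyl_of_Weyl_inverse_op:
  assumes f: "smooth_on (- {0}) f" "\<forall>x. a < \<bar>x\<bar> \<longrightarrow> f x = 0" and f0: "f 0 = 0"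
    and \<phi>: "\<phi> \<in> test_functions_on b" and eq: "\<And>x. x \<noteq> 0 \<Longrightarrow> Weyl_inverse_op \<alpha> f x = \<phi> x"
    and \<alpha>: "\<alpha> > -1/2"
  shows "Weyl \<alpha> \<phi> y = Weyl_inverse_factor \<alpha> *\<^sub>R f y"
proof (cases "y = 0")
  case False
  define \<sigma> where "\<sigma> = sgn y"
  define \<beta> where "\<beta> = \<alpha> + 1/2"
  define k where "k = index_k \<alpha>"
  define r where "r = index_r \<alpha>"
  define G where "G n = fold_half \<sigma> ((ddx2 ^^ n) f)" for n
  have \<sigma>: "\<sigma> \<in> {1, -1}" unfolding \<sigma>_def by (rule sgn_ne[OF False])
  have \<beta>: "\<beta> > 0" using \<alpha> by (simp add: \<beta>_def)
  have r: "-1/2 < r" "r \<le> 1/2" "\<alpha> = real k + r"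
    unfolding k_def r_def using index_r_bounds[OF \<alpha>] by auto
  have y2: "y\<^sup>2 > 0" using False by simp
  then have sub: "{y\<^sup>2..} \<subseteq> {0<..}"
    by (meson atLeast_iff greaterThan_iff order_less_le_trans subsetI)
  note G = fold_half_funpow_ddx2(1)[OF f \<sigma>, folded G_def]
    fold_half_funpow_ddx2(2)[OF f \<sigma>, folded G_def]
  have G': "eventually_zero_cts {y\<^sup>2..} (G n)" for n
    by (rule eventually_zero_cts_subset[OF G(1) sub])
  have iter: "frac_integral (real k + 1) (G (k + 1)) (y\<^sup>2) = ((-1) ^ (k + 1) * fact k) *\<^sub>R f y"
    using frac_integral_iterated_deriv[of G, OF G y2]
    by (simp add: G_def \<sigma>_def fold_half_sgn_power2)
  have W: "Weyl \<alpha> \<phi> y = Weyl_factor \<alpha> *\<^sub>R frac_integral \<beta> (fold_half \<sigma> \<phi>) (y\<^sup>2)"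
    using Weyl_eq_frac_integral[OF test_functions_onD(5,2)[OF \<phi>] \<alpha> False] by (simp add: \<beta>_def \<sigma>_def)
  show ?thesis
  proof (cases "r = 1/2")
    case True
    have "frac_integral \<beta> (fold_half \<sigma> \<phi>) (y\<^sup>2) = frac_integral \<beta> (G (k + 1)) (y\<^sup>2)"
    proof (rule frac_integral_cong)
      fix u assume "u > y\<^sup>2"
      then have "\<sigma> * sqrt u \<noteq> 0" using \<sigma> y2 by auto
      from eq[OF this] show "fold_half \<sigma> \<phi> u = G (k + 1) u"
        using True by (simp add: G_def fold_half_def Weyl_inverse_op_def r_def k_def del: funpow.simps)
    qed
    also have "\<dots> = ((-1) ^ (k + 1) * fact k) *\<^sub>R f y"
    proof -
      have "\<beta> = real k + 1" using r True by (simp add: \<beta>_def)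
      then show ?thesis using iter by simp
    qed
    finally show ?thesis
      using True unfolding W by (simp add: Weyl_inverse_factor_def k_def r_def mult.commute)
  next
    case False
    define \<gamma> where "\<gamma> = 1/2 - r"
    have \<gamma>: "\<gamma> > 0" "\<beta> + \<gamma> = real k + 1" using False r by (auto simp: \<gamma>_def \<beta>_def)
    have "frac_integral \<beta> (fold_half \<sigma> \<phi>) (y\<^sup>2)
        = frac_integral \<beta> (\<lambda>u. 1/2 * frac_integral \<gamma> (G (k + 1)) u + 0 * frac_integral \<gamma> (G (k + 1)) u) (y\<^sup>2)"
    proof (rule frac_integral_cong)
      fix u assume "u > y\<^sup>2"
      then have u: "u > 0" using y2 by linarith
      then have x: "\<sigma> * sqrt u \<noteq> 0" using \<sigma> by auto
      have s: "sgn (\<sigma> * sqrt u) = \<sigma>" "(\<sigma> * sqrt u)\<^sup>2 = u" using u \<sigma> by (auto simp: sgn_if)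
      have "fold_half \<sigma> \<phi> u = radial_integral \<gamma> ((ddx2 ^^ (k + 1)) f) (\<sigma> * sqrt u)"
        using eq[OF x] False
        by (simp add: fold_half_def Weyl_inverse_op_def r_def k_def \<gamma>_def del: funpow.simps)
      also have "\<dots> = (1 / 2) *\<^sub>R frac_integral \<gamma> (G (k + 1)) u"
        using radial_integral_eq_frac_integral[OF
            smooth_on_imp_continuous_on[OF smooth_on_funpow_ddx2[OF f(1)]]
            funpow_ddx2_eq_0[OF f(2)] \<gamma>(1) x, of "k + 1"]
        unfolding s G_def .
      finally show "fold_half \<sigma> \<phi> u
          = 1/2 * frac_integral \<gamma> (G (k + 1)) u + 0 * frac_integral \<gamma> (G (k + 1)) u"
        by (simp add: scaleR_conv_of_real)
    qed
    also have "\<dots> = 1/2 * frac_integral \<beta> (frac_integral \<gamma> (G (k + 1))) (y\<^sup>2)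
        + 0 * frac_integral \<beta> (frac_integral \<gamma> (G (k + 1))) (y\<^sup>2)"
      by (intro frac_integral_lincomb[of "y\<^sup>2"] eventually_zero_cts_frac_integral G' \<gamma> \<beta> order_refl)
    also have "frac_integral \<beta> (frac_integral \<gamma> (G (k + 1))) (y\<^sup>2)
        = Beta \<beta> \<gamma> *\<^sub>R (((-1) ^ (k + 1) * fact k) *\<^sub>R f y)"
      using frac_integral_frac_integral[OF G' \<beta> \<gamma>(1) order_refl, of "k + 1"] unfolding \<gamma>(2) iter .
    finally show ?thesis
      using False unfolding W
      by (simp add: Weyl_inverse_factor_def k_def r_def \<gamma>_def \<beta>_def scaleR_conv_of_real Beta_commute)
  qed
qed (simp add: f0)

text \<open>Substitution y = |x| t with e = -r - 1/2: the kernel yields |x|^(2e), and the factor y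
  and the measure dy one |x| each, in total |x|^(1-2r).\<close>

lemma Delta_integral_eq_radial_integral:
  assumes "x \<noteq> 0"
  shows "Delta_integral \<alpha> f x = (\<bar>x\<bar> powr (2 * index_r \<alpha> - 1)) *\<^sub>R
    radial_integral (1/2 - index_r \<alpha>) ((ddx2 ^^ (index_k \<alpha> + 1)) f) x"
proof -
  define r where "r = index_r \<alpha>"
  define F where "F = (ddx2 ^^ (index_k \<alpha> + 1)) f"
  define e where "e = - r - 1/2"
  have e: "1/2 - r - 1 = e" by (simp add: e_def)
  have "radial_integral (1/2 - r) F x =
      (LBINT y. indicator {\<bar>x\<bar>..} y *\<^sub>R (((y\<^sup>2 - x\<^sup>2) powr e * y) *\<^sub>R F (sgn x * y)))"
    unfolding radial_integral_def set_lebesgue_integral_def e ..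
  also have "\<dots> = \<bar>\<bar>x\<bar>\<bar> *\<^sub>R (LBINT t. indicator {\<bar>x\<bar>..} (0 + \<bar>x\<bar> * t) *\<^sub>R
      ((((0 + \<bar>x\<bar> * t)\<^sup>2 - x\<^sup>2) powr e * (0 + \<bar>x\<bar> * t)) *\<^sub>R F (sgn x * (0 + \<bar>x\<bar> * t))))"
    by (rule lborel_integral_real_affine) (use assms in simp)
  also have "(\<lambda>t. indicator {\<bar>x\<bar>..} (0 + \<bar>x\<bar> * t) *\<^sub>R
      ((((0 + \<bar>x\<bar> * t)\<^sup>2 - x\<^sup>2) powr e * (0 + \<bar>x\<bar> * t)) *\<^sub>R F (sgn x * (0 + \<bar>x\<bar> * t))))
    = (\<lambda>t. (\<bar>x\<bar> powr (2 * e + 1)) *\<^sub>R (indicator {1..} t *\<^sub>R (((t\<^sup>2 - 1) powr e * t) *\<^sub>R F (x * t))))"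
  proof
    fix t :: real
    show "indicator {\<bar>x\<bar>..} (0 + \<bar>x\<bar> * t) *\<^sub>R
      ((((0 + \<bar>x\<bar> * t)\<^sup>2 - x\<^sup>2) powr e * (0 + \<bar>x\<bar> * t)) *\<^sub>R F (sgn x * (0 + \<bar>x\<bar> * t)))
    = (\<bar>x\<bar> powr (2 * e + 1)) *\<^sub>R (indicator {1..} t *\<^sub>R (((t\<^sup>2 - 1) powr e * t) *\<^sub>R F (x * t)))"
    proof (cases "t \<ge> 1")
      case True
      then have "(0 + \<bar>x\<bar> * t)\<^sup>2 - x\<^sup>2 = \<bar>x\<bar>\<^sup>2 * (t\<^sup>2 - 1)" "t\<^sup>2 - 1 \<ge> 0"
        by (auto simp: power_mult_distrib algebra_simps)
      then have "((0 + \<bar>x\<bar> * t)\<^sup>2 - x\<^sup>2) powr e = (\<bar>x\<bar>\<^sup>2) powr e * (t\<^sup>2 - 1) powr e"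
        by (simp add: powr_mult)
      also have "\<bar>x\<bar>\<^sup>2 = \<bar>x\<bar> powr 2"
        using assms by simp
      also have "(\<bar>x\<bar> powr 2) powr e = \<bar>x\<bar> powr (2 * e)"
        by (rule powr_powr)
      finally have A: "((0 + \<bar>x\<bar> * t)\<^sup>2 - x\<^sup>2) powr e * (0 + \<bar>x\<bar> * t)
          = \<bar>x\<bar> powr (2 * e + 1) * ((t\<^sup>2 - 1) powr e * t)"
        using assms by (simp add: powr_add)
      have B: "sgn x * (0 + \<bar>x\<bar> * t) = x * t"
        by (simp add: sgn_mult_abs mult.assoc[symmetric])
      have "\<bar>x\<bar> \<le> \<bar>x\<bar> * t" using True assms by simp
      then show ?thesis unfolding A B using True by simp
    next
      case False
      then have "\<not> \<bar>x\<bar> \<le> \<bar>x\<bar> * t" using assms by simp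
      then show ?thesis using False by simp
    qed
  qed
  also have "(LBINT t. (\<bar>x\<bar> powr (2 * e + 1)) *\<^sub>R (indicator {1..} t *\<^sub>R (((t\<^sup>2 - 1) powr e * t) *\<^sub>R F (x * t))))
      = (\<bar>x\<bar> powr (2 * e + 1)) *\<^sub>R Delta_integral \<alpha> f x"
    unfolding Delta_integral_def set_lebesgue_integral_def F_def r_def[symmetric] e_def[symmetric]
    by (rule integral_scaleR_right)
  finally have eq: "radial_integral (1/2 - r) F x = (\<bar>x\<bar> * \<bar>x\<bar> powr (2 * e + 1)) *\<^sub>R Delta_integral \<alpha> f x"
    by simp
  have "\<bar>x\<bar> powr (2 * r - 1) * (\<bar>x\<bar> * \<bar>x\<bar> powr (2 * e + 1)) = \<bar>x\<bar> powr ((2 * r - 1) + 1 + (2 * e + 1))"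
    using assms by (simp only: powr_add powr_one abs_ge_zero mult.assoc)
  also have "\<dots> = 1" using assms by (simp add: e_def)
  finally show ?thesis
    unfolding r_def[symmetric] F_def[symmetric] eq by simp
qed

text \<open>The nonzero weight |x|^(2r-1) cancels for x \<noteq> 0, which merges the two cases into
  one condition.\<close>

lemma Delta_on_iff:
  "f \<in> Delta_on \<alpha> a \<longleftrightarrow> f \<in> K0 \<and> (\<forall>x. a < \<bar>x\<bar> \<longrightarrow> f x = 0) \<and>
     (\<exists>\<phi>\<in>test_functions. \<forall>x. x \<noteq> 0 \<longrightarrow> Weyl_inverse_op \<alpha> f x = \<phi> x)"
proof -
  have "(if index_r \<alpha> = 1/2 then (ddx2 ^^ (index_k \<alpha> + 1)) f x = \<phi> x
      else Delta_integral \<alpha> f x = (\<bar>x\<bar> powr (2 * index_r \<alpha> - 1)) *\<^sub>R \<phi> x)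
    \<longleftrightarrow> Weyl_inverse_op \<alpha> f x = \<phi> x" if "x \<noteq> 0" for x \<phi>
    using that by (simp add: Weyl_inverse_op_def Delta_integral_eq_radial_integral del: funpow.simps)
  then show ?thesis
    unfolding Delta_on_def fun_support_subset_iff by simp
qed

lemma K0_D: "f \<in> K0 \<Longrightarrow> smooth_on (- {0}) f" "f \<in> K0 \<Longrightarrow> f 0 = 0"
  by (auto simp: K0_def)

lemma test_functions_on_scaleR: "f \<in> test_functions_on a \<Longrightarrow> (\<lambda>x. c *\<^sub>R f x) \<in> test_functions_on a"
  using test_functions_on_lincomb[of f a f "of_real c" 0] by (simp add: scaleR_conv_of_real)

lemma test_functions_on_mono: "a \<le> b \<Longrightarrow> test_functions_on a \<subseteq> test_functions_on b"
  by (auto simp: test_functions_on_iff)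

lemma Weyl_image_test_functions_on:
  assumes a: "a \<ge> 0" and \<alpha>: "\<alpha> > -1/2"
  shows "Weyl \<alpha> ` test_functions_on a = Delta_on \<alpha> a"
proof (intro equalityI subsetI)
  fix g assume "g \<in> Weyl \<alpha> ` test_functions_on a"
  then obtain f where f: "f \<in> test_functions_on a" "g = Weyl \<alpha> f" by blast
  have "(\<lambda>x. Weyl_inverse_factor \<alpha> *\<^sub>R f x) \<in> test_functions"
    using test_functions_on_scaleR[OF f(1)] a by (auto simp: test_functions_def)
  then show "g \<in> Delta_on \<alpha> a"
    unfolding Delta_on_iff f(2)
    using Weyl_in_K0(1)[OF f(1) \<alpha>] Weyl_eq_0[OF test_functions_onD(2)[OF f(1)]] Weyl_inverse_op_Weyl[OF f(1) \<alpha>]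
    by (intro conjI bexI[of _ "\<lambda>x. Weyl_inverse_factor \<alpha> *\<^sub>R f x"]) auto
next
  fix g assume "g \<in> Delta_on \<alpha> a"
  then obtain \<phi> b where g: "g \<in> K0" "\<forall>x. a < \<bar>x\<bar> \<longrightarrow> g x = 0"
    and \<phi>: "\<phi> \<in> test_functions_on b" "\<And>x. x \<noteq> 0 \<Longrightarrow> Weyl_inverse_op \<alpha> g x = \<phi> x"
    unfolding Delta_on_iff test_functions_def by blast
  have W: "Weyl \<alpha> \<phi> = (\<lambda>y. Weyl_inverse_factor \<alpha> *\<^sub>R g y)"
    using Weyl_of_Weyl_inverse_op[OF K0_D(1)[OF g(1)] g(2) K0_D(2)[OF g(1)] \<phi> \<alpha>] by blast
  \<comment> \<open>The interval of \<phi> is a priori unrelated to a; \<phi> inherits the support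
    of g because its values depend only on g further out. As a \<ge> 0, the point 0, where \<phi> is
    not given by g, does not occur.\<close>
  have zero: "\<phi> x = 0" if "a < \<bar>x\<bar>" for x
  proof -
    have "x \<noteq> 0" using that a by auto
    then show ?thesis
      using radial_integral_eq_0[OF funpow_ddx2_eq_0[OF g(2)] that] funpow_ddx2_eq_0[OF g(2)] that
      by (simp add: Weyl_inverse_op_def flip: \<phi>(2) del: funpow.simps)
  qed
  let ?f = "\<lambda>x. (1 / Weyl_inverse_factor \<alpha>) *\<^sub>R \<phi> x"
  have "\<phi> \<in> test_functions_on a" using \<phi>(1) zero by (simp add: test_functions_on_iff)
  then have f: "?f \<in> test_functions_on a" by (rule test_functions_on_scaleR)
  have "Weyl \<alpha> ?f = g"
  proof
    fix y
    show "Weyl \<alpha> ?f y = g y"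
      using fun_cong[OF Weyl_lincomb[OF \<phi>(1) \<phi>(1) \<alpha>, of "of_real (1 / Weyl_inverse_factor \<alpha>)" 0], of y]
        fun_cong[OF W, of y] Weyl_inverse_factor_nonzero[OF \<alpha>]
      by (simp add: scaleR_conv_of_real)
  qed
  then show "g \<in> Weyl \<alpha> ` test_functions_on a" using f by blast
qed

lemma inj_on_Weyl:
  assumes \<alpha>: "\<alpha> > -1/2"
  shows "inj_on (Weyl \<alpha>) test_functions"
proof (rule inj_onI)
  fix f g assume "f \<in> test_functions" "g \<in> test_functions" and eq: "Weyl \<alpha> f = Weyl \<alpha> g"
  then obtain a b where f: "f \<in> test_functions_on a" and g: "g \<in> test_functions_on b"
    by (auto simp: test_functions_def)
  have "f x = g x" if "x \<noteq> 0" for x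
    using Weyl_inverse_op_Weyl[OF f \<alpha> that] Weyl_inverse_op_Weyl[OF g \<alpha> that] eq
      Weyl_inverse_factor_nonzero[OF \<alpha>] by simp
  \<comment> \<open>Inversion gives equality off 0 only; uniqueness of smooth extensions supplies
    the value at 0.\<close>
  then have "smooth_extension f = g"
    by (intro smooth_extension_eqI test_functions_onD(1)[OF g]) simp
  moreover have "smooth_extension f = f"
    by (intro smooth_extension_eqI test_functions_onD(1)[OF f]) simp
  ultimately show "f = g" by simp
qed

section \<open>Scaling of the seminorms\<close>

lemma funpow_vderiv_scaleR:
  assumes "smooth_on UNIV f"
  shows "(vderiv ^^ n) (\<lambda>x. c *\<^sub>R f x) = (\<lambda>x. c *\<^sub>R (vderiv ^^ n) f x)"
proof (induction n)
  case (Suc n)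
  have "vderiv (\<lambda>x. c *\<^sub>R (vderiv ^^ n) f x) x = c *\<^sub>R vderiv ((vderiv ^^ n) f) x" for x
    unfolding vderiv_def[of "\<lambda>x. c *\<^sub>R (vderiv ^^ n) f x"]
    using smooth_on_has_vector_derivative[OF assms, of x n]
    by (intro vector_derivative_at bounded_linear.has_vector_derivative[OF bounded_linear_scaleR_right]) auto
  then show ?case
    unfolding funpow.simps(2) comp_apply Suc by (rule ext)
qed simp

lemma sup_deriv_scaleR:
  assumes f: "smooth_on UNIV f" and a: "a \<ge> 0" and c: "c \<noteq> 0"
  shows "sup_deriv a n (\<lambda>x. c *\<^sub>R f x) = \<bar>c\<bar> * sup_deriv a n f"
proof -
  let ?A = "{..n} \<times> {-a..a}"
  let ?h = "\<lambda>(p, x). cmod ((vderiv ^^ p) f x)"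
  have ne: "?A \<noteq> {}" using a by auto
  \<comment> \<open>Real suprema obey the usual rules only for bounded nonempty families; the bound
    comes from compactness for each of finitely many orders.\<close>
  have bdd: "bdd_above (?h ` ?A)"
  proof -
    have "bdd_above ((\<lambda>x. cmod ((vderiv ^^ p) f x)) ` {-a..a})" for p
    proof -
      have "isCont ((vderiv ^^ p) f) x" for x
        using has_vector_derivative_continuous[OF smooth_on_has_vector_derivative[OF f]] by simp
      then have "continuous_on {-a..a} (\<lambda>x. cmod ((vderiv ^^ p) f x))"
        by (intro continuous_on_norm continuous_at_imp_continuous_on) auto
      then show ?thesis
        by (intro bounded_imp_bdd_above compact_imp_bounded compact_continuous_image) auto
    qed
    then have "bdd_above (\<Union>p\<in>{..n}. (\<lambda>x. cmod ((vderiv ^^ p) f x)) ` {-a..a})"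
      by (subst bdd_above_UN) auto
    also have "(\<Union>p\<in>{..n}. (\<lambda>x. cmod ((vderiv ^^ p) f x)) ` {-a..a}) = ?h ` ?A" by force
    finally show ?thesis .
  qed
  have "sup_deriv a n (\<lambda>x. c *\<^sub>R f x) = (SUP z\<in>?A. \<bar>c\<bar> * ?h z)"
    unfolding sup_deriv_def funpow_vderiv_scaleR[OF f] by (simp add: case_prod_unfold)
  also have "\<dots> = \<bar>c\<bar> * (SUP z\<in>?A. ?h z)"
  proof (rule antisym)
    show "(SUP z\<in>?A. \<bar>c\<bar> * ?h z) \<le> \<bar>c\<bar> * (SUP z\<in>?A. ?h z)"
      by (rule cSUP_least[OF ne]) (intro mult_left_mono cSUP_upper bdd, auto)
    have "bdd_above ((\<lambda>z. \<bar>c\<bar> * ?h z) ` ?A)"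
    proof -
      obtain M where M: "\<And>z. z \<in> ?A \<Longrightarrow> ?h z \<le> M" using bdd unfolding bdd_above_def by blast
      show ?thesis by (rule bdd_aboveI2[of _ _ "\<bar>c\<bar> * M"]) (intro mult_left_mono M, auto)
    qed
    then have "(SUP z\<in>?A. ?h z) \<le> (SUP z\<in>?A. \<bar>c\<bar> * ?h z) / \<bar>c\<bar>"
    proof (intro cSUP_least[OF ne])
      fix z assume b: "bdd_above ((\<lambda>z. \<bar>c\<bar> * ?h z) ` ?A)" and z: "z \<in> ?A"
      show "?h z \<le> (SUP z\<in>?A. \<bar>c\<bar> * ?h z) / \<bar>c\<bar>"
        using cSUP_upper[OF z b] c by (simp add: pos_le_divide_eq mult.commute)
    qed
    then show "\<bar>c\<bar> * (SUP z\<in>?A. ?h z) \<le> (SUP z\<in>?A. \<bar>c\<bar> * ?h z)"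
      using c by (simp add: pos_le_divide_eq mult.commute)
  qed
  finally show ?thesis by (simp add: sup_deriv_def)
qed

text \<open>Off 0 the function under the seminorm is a constant multiple of f. This multiple is
  smooth on the line, hence is the extension chosen by \<open>smooth_extension\<close>.\<close>

lemma Delta_seminorm_Weyl:
  assumes f: "f \<in> test_functions_on a" and a: "a \<ge> 0" and \<alpha>: "\<alpha> > -1/2"
  shows "Delta_seminorm \<alpha> a n (Weyl \<alpha> f) = \<bar>Weyl_inverse_factor \<alpha>\<bar> * sup_deriv a n f"
proof -
  let ?h = "if index_r \<alpha> = 1/2 then (ddx2 ^^ (index_k \<alpha> + 1)) (Weyl \<alpha> f)
      else (\<lambda>x. (\<bar>x\<bar> powr (1 - 2 * index_r \<alpha>)) *\<^sub>R Delta_integral \<alpha> (Weyl \<alpha> f) x)"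
  have "smooth_extension ?h = (\<lambda>x. Weyl_inverse_factor \<alpha> *\<^sub>R f x)"
  proof (rule smooth_extension_eqI)
    show "smooth_on UNIV (\<lambda>x. Weyl_inverse_factor \<alpha> *\<^sub>R f x)"
      by (rule test_functions_onD(1)[OF test_functions_on_scaleR[OF f]])
    fix x :: real assume x: "x \<noteq> 0"
    have "\<bar>x\<bar> powr (1 - 2 * index_r \<alpha>) * \<bar>x\<bar> powr (2 * index_r \<alpha> - 1) = 1"
      using x by (simp flip: powr_add)
    then have "?h x = Weyl_inverse_op \<alpha> (Weyl \<alpha> f) x"
      using x by (simp add: Weyl_inverse_op_def Delta_integral_eq_radial_integral del: funpow.simps)
    then show "Weyl_inverse_factor \<alpha> *\<^sub>R f x = ?h x"
      using Weyl_inverse_op_Weyl[OF f \<alpha> x] by simp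
  qed
  then show ?thesis
    unfolding Delta_seminorm_def
    using sup_deriv_scaleR[OF test_functions_onD(1)[OF f] a Weyl_inverse_factor_nonzero[OF \<alpha>]] by simp
qed

text \<open>For \<alpha> = k + 1/2 this is Gamma (\<alpha> + 1), the origin of the factorials in the
  constant of V.\<close>

lemma Gamma_half_integer: "Gamma (real k + 3/2) = fact (2 * k + 1) / (2 ^ (2 * k + 1) * fact k) * sqrt pi"
proof (induction k)
  case 0
  have "Gamma (1/2 + 1 :: real) = 1/2 * Gamma (1/2)"
    by (rule Gamma_plus1) (auto elim!: nonpos_Ints_cases)
  then show ?case by (simp add: Gamma_one_half_real)
next
  case (Suc k)
  have "Gamma ((real k + 3/2) + 1) = (real k + 3/2) * Gamma (real k + 3/2)"
    by (rule Gamma_plus1) (auto elim!: nonpos_Ints_cases)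
  then have "Gamma (real (Suc k) + 3/2) = (real k + 3/2) * Gamma (real k + 3/2)"
    by (simp add: algebra_simps)
  also have "\<dots> = (2 * real k + 3) * (2 * real k + 2) * fact (2 * k + 1) /
      (4 * 2 ^ (2 * k + 1) * ((real k + 1) * fact k)) * sqrt pi"
  proof -
    \<comment> \<open>Stated with variables for the factorials and powers, so that clearing
      denominators does not unfold them.\<close>
    have "(x + 3/2) * (A / (P * B) * C) = (2 * x + 3) * (2 * x + 2) * A / (4 * P * ((x + 1) * B)) * C"
      if "P > 0" "B > 0" "x \<ge> 0" for A B C P x :: real
      using that by (simp add: divide_simps)
    then show ?thesis unfolding Suc by simp
  qed
  also have "(2 * real k + 3) * (2 * real k + 2) * fact (2 * k + 1) = fact (2 * Suc k + 1)"
    by (simp add: algebra_simps)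
  also have "4 * 2 ^ (2 * k + 1) * ((real k + 1) * fact k) = 2 ^ (2 * Suc k + 1) * fact (Suc k)"
    by simp
  finally show ?case .
qed

lemma inverse_Weyl_Weyl:
  assumes f: "f \<in> test_functions_on a" and \<alpha>: "\<alpha> > -1/2"
  shows "inverse_Weyl \<alpha> (Weyl \<alpha> f) = f"
proof -
  define k where "k = index_k \<alpha>"
  define r where "r = index_r \<alpha>"
  have r: "-1/2 < r" "r \<le> 1/2" "\<alpha> = real k + r"
    unfolding k_def r_def using index_r_bounds[OF \<alpha>] by auto
  \<comment> \<open>The constant of V in either case; it turns out to be the reciprocal of
    \<open>Weyl_inverse_factor\<close>.\<close>
  define c where "c = (if r = 1/2 then (-1) ^ (k + 1) * (2 ^ (2 * k + 1) * fact k / fact (2 * k + 1))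
    else (-1) ^ (k + 1) * 2 * sqrt pi / (Gamma (\<alpha> + 1) * Gamma (1/2 - r)))"
  have exponent: "1/2 - r - 1 = - r - 1/2" by simp
  have Gk: "Gamma (real k + 1) = fact k" using Gamma_fact[of k, where 'a = real] by (simp add: add.commute)
  have sgn_sq: "(-1::real) ^ (k + 1) * (-1) ^ (k + 1) = 1" by (simp flip: power_mult_distrib)
  have c: "c * Weyl_inverse_factor \<alpha> = 1"
  proof (cases "r = 1/2")
    case True
    then have \<alpha>_eq: "\<alpha> + 1 = real k + 3/2" "\<alpha> + 1/2 = real k + 1" using r by auto
    have "Weyl_factor \<alpha> = fact (2 * k + 1) / (2 ^ (2 * k + 1) * fact k) / fact k"
      unfolding Weyl_factor_def \<alpha>_eq Gamma_half_integer Gk by simp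
    then have "c * Weyl_inverse_factor \<alpha> = ((-1) ^ (k + 1) * (-1) ^ (k + 1)) *
        ((2 ^ (2 * k + 1) * fact k / fact (2 * k + 1)) * (fact k * (fact (2 * k + 1) / (2 ^ (2 * k + 1) * fact k) / fact k)))"
      unfolding c_def Weyl_inverse_factor_def k_def[symmetric] r_def[symmetric] if_P[OF True]
      by (simp only: mult.assoc mult.left_commute mult_1_right)
    also have "\<dots> = 1" unfolding sgn_sq by (simp del: fact_Suc)
    finally show ?thesis .
  next
    case False
    define g1 g2 g3 where g: "g1 = Gamma (\<alpha> + 1)" "g2 = Gamma (1/2 - r)" "g3 = Gamma (\<alpha> + 1/2)"
    have "g1 > 0" "g2 > 0" "g3 > 0" unfolding g using r \<alpha> False by (auto intro!: Gamma_real_pos)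
    moreover have "Beta (1/2 - r) (\<alpha> + 1/2) = g2 * g3 / fact k"
    proof -
      \<comment> \<open>The arguments of \<open>Beta\<close> add up to k + 1, so its denominator is
        k! and cancels the factorial from the integrations by parts.\<close>
      have "1/2 - r + (\<alpha> + 1/2) = real k + 1" using r by simp
      then show ?thesis unfolding Beta_def g Gk[symmetric] by (simp only:)
    qed
    then have "c * Weyl_inverse_factor \<alpha> = ((-1) ^ (k + 1) * (-1) ^ (k + 1)) *
        ((2 * sqrt pi / (g1 * g2)) * (fact k * (g1 / (sqrt pi * g3)) * (1 / 2 * (g2 * g3 / fact k))))"
      using False unfolding c_def Weyl_inverse_factor_def k_def[symmetric] r_def[symmetric] Weyl_factor_def
      by (simp add: g)
    ultimately show ?thesis unfolding sgn_sq by (simp add: field_simps)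
  qed
  show ?thesis
    unfolding inverse_Weyl_def Let_def k_def[symmetric] r_def[symmetric]
  proof (rule smooth_extension_eqI[OF test_functions_onD(1)[OF f]])
    fix x :: real assume x: "x \<noteq> 0"
    have "f x = c *\<^sub>R Weyl_inverse_op \<alpha> (Weyl \<alpha> f) x"
      unfolding Weyl_inverse_op_Weyl[OF f \<alpha> x] using c by simp
    then show "f x = (if r = 1 / 2
      then ((- 1) ^ (k + 1) * (2 ^ (2 * k + 1) * fact k / fact (2 * k + 1))) *\<^sub>R (ddx2 ^^ (k + 1)) (Weyl \<alpha> f) x
      else ((- 1) ^ (k + 1) * 2 * sqrt pi / (Gamma (\<alpha> + 1) * Gamma (1 / 2 - r))) *\<^sub>R
        (LBINT y:{\<bar>x\<bar>..}. ((y\<^sup>2 - x\<^sup>2) powr (- r - 1 / 2) * y) *\<^sub>R (ddx2 ^^ (k + 1)) (Weyl \<alpha> f) (sgn x * y)))"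
      unfolding Weyl_inverse_op_def radial_integral_def k_def[symmetric] r_def[symmetric] exponent c_def
      by (cases "r = 1/2") (simp_all only: if_True if_False simp_thms)
  qed
qed

theorem theorem3p4:
  fixes \<alpha> :: real
  assumes "\<alpha> > -1/2"
  shows "topological_isomorphism test_topology (Delta_topology \<alpha>) (Weyl \<alpha>) \<and>
    (\<forall>g\<in>Delta \<alpha>. the_inv_into test_functions (Weyl \<alpha>) g = inverse_Weyl \<alpha> g)"
proof (intro conjI ballI)
  show "topological_isomorphism test_topology (Delta_topology \<alpha>) (Weyl \<alpha>)"
    unfolding test_topology_def Delta_topology_def
  proof (rule topological_isomorphism_inductive_limit[where E = test_functions_on and c = "\<bar>Weyl_inverse_factor \<alpha>\<bar>", folded test_functions_def])
    show "Weyl \<alpha> (\<lambda>x. s * f x + t * g x) = (\<lambda>x. s * Weyl \<alpha> f x + t * Weyl \<alpha> g x)"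
      if fg: "f \<in> test_functions" "g \<in> test_functions" for f g s t
    proof -
      obtain a b where "f \<in> test_functions_on a" "g \<in> test_functions_on b"
        using fg by (auto simp: test_functions_def)
      then have "f \<in> test_functions_on (max a b)" "g \<in> test_functions_on (max a b)"
        using test_functions_on_mono[of a "max a b"] test_functions_on_mono[of b "max a b"] by auto
      then show ?thesis using assms by (rule Weyl_lincomb)
    qed
    show "Delta_on \<alpha> a \<subseteq> Delta_on \<alpha> b" if "a \<le> b" for a b
      using that by (auto simp: Delta_on_iff)
    show "Weyl \<alpha> ` test_functions_on a = Delta_on \<alpha> a" if "a \<ge> 0" for a
      using that assms by (rule Weyl_image_test_functions_on)
    show "Delta_seminorm \<alpha> a n (Weyl \<alpha> f) = \<bar>Weyl_inverse_factor \<alpha>\<bar> * sup_deriv a n f"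
      if "a \<ge> 0" "f \<in> test_functions_on a" for a n f
      using that assms by (intro Delta_seminorm_Weyl)
    show "(\<lambda>x. 0) \<in> test_functions_on a" for a by (simp add: test_functions_on_def)
    show "(\<lambda>x. s * f x + t * g x) \<in> test_functions_on a"
      if "f \<in> test_functions_on a" "g \<in> test_functions_on a" for a f g s t
      using that by (rule test_functions_on_lincomb)
    show "0 < \<bar>Weyl_inverse_factor \<alpha>\<bar>" using Weyl_inverse_factor_nonzero[OF assms] by simp
  qed (use assms in \<open>auto intro: test_functions_on_mono[THEN subsetD] inj_on_Weyl\<close>)
  fix g assume "g \<in> Delta \<alpha>"
  then obtain a where a: "a \<ge> 0" "g \<in> Delta_on \<alpha> a" by (auto simp: Delta_def)
  \<comment> \<open>Surjectivity onto \<open>Delta_on\<close> turns the left inverse of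
    \<open>inverse_Weyl_Weyl\<close> into the inverse on all of \<open>Delta\<close>.\<close>
  then obtain f where f: "f \<in> test_functions_on a" "g = Weyl \<alpha> f"
    using Weyl_image_test_functions_on[OF a(1) assms] by blast
  then have "f \<in> test_functions" using a(1) by (auto simp: test_functions_def)
  then show "the_inv_into test_functions (Weyl \<alpha>) g = inverse_Weyl \<alpha> g"
    unfolding f(2) inverse_Weyl_Weyl[OF f(1) assms] by (intro the_inv_into_f_f inj_on_Weyl assms)
qed

end
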